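(* Let $k,\ell \geq 2$ and $\epsilon \geq 0$ be fixed. For each $n$, let $H=H_n$ be a $2$-colorable $k$-uniform hypergraph on $n$ vertices with $\Omega(n^{k-\epsilon})$ edges. Let $H'$ be obtained by adding to $H$ a collection $R$ of $\omega\big(n^{\ell\epsilon/2}\big)$ random $\ell$-tuples on the vertex set of $H$. Then $H'$ is almost surely non-$2$-colorable.
   Context: A $k$-uniform hypergraph is a pair $(V,E)$ with $E$ a family of distinct $k$-subsets of $V$. A collection of $m$ random $\ell$-tuples on an $n$-element set $V$ consists of $m$ $\ell$-element subsets of $V$, each chosen independently and uniformly at random among all $\binom{n}{\ell}$ such subsets. $H+R$ denotes the hypergraph on $V$ whose edges are the edges of $H$ together with the $\ell$-sets in $R$. A $2$-coloring of a (not necessarily uniform) hypergraph is a partition of its vertex set into two classes such that no edge is monochromatic; the hypergraph is $2$-colorable if such a coloring exists. "Almost surely" means with probability tending to $1$ as $n\to\infty$. Asymptotic notation is as $n\to\infty$ with $k,\ell,\epsilon$ fixed; $a_n=\omega(b_n)$ means $a_n/b_n\to\infty$. *)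

theory Defs
  imports "HOL-Probability.Probability" "HOL-Library.Landau_Symbols"
begin

type_synonym 'a hypergraph = "'a set \<times> 'a set set"

abbreviation verts :: "'a hypergraph \<Rightarrow> 'a set" where "verts \<equiv> fst"
abbreviation edges :: "'a hypergraph \<Rightarrow> 'a set set" where "edges \<equiv> snd"

definition uniform_hypergraph :: "nat \<Rightarrow> 'a hypergraph \<Rightarrow> bool" where
  "uniform_hypergraph k H \<longleftrightarrow>
     finite (verts H) \<and> (\<forall>e\<in>edges H. e \<subseteq> verts H \<and> card e = k)"

text \<open>Colour classes may be empty, so that a hypergraph on fewer than two vertices
  without edges is 2-colorable.\<close>

definition two_colorable :: "'a hypergraph \<Rightarrow> bool" where
  "two_colorable H \<longleftrightarrow>
     (\<exists>A B. A \<union> B = verts H \<and> A \<inter> B = {} \<and> (\<forall>e\<in>edges H. \<not> e \<subseteq> A \<and> \<not> e \<subseteq> B))"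

text \<open>The law of \<open>m\<close> independent uniformly random \<open>l\<close>-subsets \<open>R 0, \<dots>, R (m - 1)\<close> of \<open>V\<close>
  (repetitions allowed); outside \<open>{..<m}\<close> the function \<open>R\<close> takes the dummy value \<open>{}\<close>.
  Meaningful only if \<open>V\<close> is finite with \<open>l \<le> card V\<close>, since otherwise
  \<open>pmf_of_set\<close> is applied to an empty or infinite set.\<close>

definition random_tuples :: "'a set \<Rightarrow> nat \<Rightarrow> nat \<Rightarrow> (nat \<Rightarrow> 'a set) pmf" where
  "random_tuples V l m = Pi_pmf {..<m} {} (\<lambda>_. pmf_of_set {S. S \<subseteq> V \<and> card S = l})"

definition add_edges :: "'a hypergraph \<Rightarrow> 'a set set \<Rightarrow> 'a hypergraph" where
  "add_edges H F = (verts H, edges H \<union> F)"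

end

(*
Fix a proper colouring of H together with random tuples R. Call a family of sets one-sided if one
colour class contains none of its members, and two-sided if neither does. A one-sided family of
y * n^j sets of size j survives m random tuples with probability at most C * exp (- c * m * y^l):
some tuple lies among the vertices of large degree, one of its vertices has the wrong colour, and
one passes to the link of that vertex.

For a two-sided family H of p * n^k sets one must show that m >> p^(-l/2) tuples suffice, by
induction on k.

l = 2: let M(T) be the set of those u of degree at most that of every vertex of T for which
T + u is in H. If a random pair lies in M(T), then T cannot be monochromatic. By the Cauchy-Schwarz
inequality, m >> 1/p pairs certify p/2 * n^(k-1) such sets T, a two-sided family of (k-1)-sets.

l >= 3: if many j-sets T have link density at least kappa * sqrt p, then the one-sided estimate,
applied to the links, certifies most of them as not monochromatic, again a two-sided family.
Otherwise all link densities are below kappa * sqrt p. Every edge e splits as S + T into its two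
colour parts, where S has the larger link density, say; for some dyadic density level this
happens for many edges. A sequence of such sets S of suitable length q, all of one colour, produces
a one-sided family, the union of their links, so large that the one-sided failure probability beats
the proportion of such sequences among all sequences of length q. Counting the uncertified
sequences, rather than taking a union bound over colourings, gives the contradiction.
*)

theory Submission
  imports Defs "HOL-Real_Asymp.Real_Asymp"
begin

section \<open>Random families of sets\<close>

text \<open>The one-sided estimate works once \<open>m * y ^ l\<close> is large, so \<open>m\<close>
  of order \<open>p^(-l/2)\<close> makes \<open>sqrt p\<close> the critical density of a link. If
  instead links have density d below \<open>sqrt p\<close>, there are about \<open>p/d * n^a\<close>
  sets S, and a union of about \<open>p/d^2\<close> of their links has density about
  \<open>p/d\<close>, above \<open>sqrt p\<close>. With \<open>d = \<kappa> * sqrt p / 2^i\<close>,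
  such sequences have length about \<open>4^i / \<kappa>^2\<close>, which is their entropy cost up
  to a factor linear in \<open>i\<close>, while the one-sided estimate gains about
  \<open>(2^i / \<kappa>)^l\<close> in the exponent. For \<open>l \<ge> 3\<close> a small
  \<open>\<kappa>\<close> makes the gain win; for \<open>l = 2\<close> both sides have the same
  order, so pairs need another argument. A union bound over all \<open>2^n\<close> colourings would
  require \<open>m\<close> of order n. It serves only when
  \<open>l * \<epsilon> / 2 \<ge> 1\<close>; otherwise \<open>\<epsilon> < 1\<close>, so
  \<open>p * n\<close> tends to infinity, which supplies enough vertices of large degree at every
  step. Certification and further use of certified sets need independent tuples, so the tuples are
  revealed in two rounds, each with failure probability \<open>\<delta> / 2\<close>.\<close>

definition ksubs :: "'a set \<Rightarrow> nat \<Rightarrow> 'a set set" where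
  "ksubs V k = {S. S \<subseteq> V \<and> card S = k}"

lemma finite_ksubs [simp]: "finite V \<Longrightarrow> finite (ksubs V k)"
  by (simp add: ksubs_def)

lemma card_ksubs: "finite V \<Longrightarrow> card (ksubs V k) = card V choose k"
  by (simp add: ksubs_def n_subsets)

lemma ksubs_finite_elem: "finite V \<Longrightarrow> S \<in> ksubs V k \<Longrightarrow> finite S"
  by (auto simp: ksubs_def intro: finite_subset)

lemma binomial_le_power: "n choose k \<le> n ^ k"
proof -
  have "(n choose k) * 1 \<le> (n choose k) * fact k"
    by (intro mult_le_mono2 fact_ge_1)
  also have "\<dots> \<le> n ^ k"
    by (rule binomial_fact_pow)
  finally show ?thesis by simp
qed

lemma card_ksubs_le: "finite V \<Longrightarrow> card (ksubs V k) \<le> card V ^ k"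
  by (simp add: card_ksubs binomial_le_power)

lemma binomial_fact_ge_pow: "real (x - l) ^ l \<le> real (x choose l) * fact l"
proof (induction l arbitrary: x)
  case 0
  then show ?case by simp
next
  case (Suc l)
  show ?case
  proof (cases x)
    case 0
    then show ?thesis by simp
  next
    case (Suc y)
    have "real (x - Suc l) ^ Suc l = real (y - l) * real (y - l) ^ l"
      using Suc by simp
    also have "\<dots> \<le> real (Suc y) * (real (y choose l) * fact l)"
      by (intro mult_mono Suc.IH) auto
    also have "\<dots> = real (Suc y * (y choose l)) * fact l"
      by (simp add: algebra_simps)
    also have "Suc y * (y choose l) = (Suc y choose Suc l) * Suc l"
      by (rule Suc_times_binomial_eq)
    also have "real ((Suc y choose Suc l) * Suc l) * fact l = real (x choose Suc l) * fact (Suc l)"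
      unfolding Suc fact_Suc of_nat_mult by (simp only: mult.assoc of_nat_Suc)
    finally show ?thesis .
  qed
qed

text \<open>The falling factorial of \<open>n\<close> is at most \<open>n ^ l\<close>, and
  \<open>2 * l \<le> x\<close> gives \<open>x - l \<ge> x / 2\<close>; the factor 2 in the
  denominator pays for avoiding the exact quotient.\<close>

lemma choose_ratio_ge:
  assumes "2 * l \<le> x" and "0 < n"
  shows "(real x / (2 * real n)) ^ l * real (n choose l) \<le> real (x choose l)"
proof -
  have "real ((n choose l) * fact l) \<le> real (n ^ l)"
    unfolding of_nat_le_iff by (rule binomial_fact_pow)
  then have "(real x / (2 * real n)) ^ l * (real (n choose l) * fact l) \<le> (real x / (2 * real n)) ^ l * real n ^ l"
    by (intro mult_left_mono) auto
  also have "\<dots> = (real x / 2) ^ l"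
    using assms(2) by (simp flip: power_mult_distrib)
  also have "\<dots> \<le> real (x - l) ^ l"
    using assms(1) by (intro power_mono) auto
  also have "\<dots> \<le> real (x choose l) * fact l"
    by (rule binomial_fact_ge_pow)
  finally have "((real x / (2 * real n)) ^ l * real (n choose l)) * fact l \<le> real (x choose l) * fact l"
    by (simp add: mult.assoc)
  then show ?thesis
    by (rule mult_right_le_imp_le) simp
qed

section \<open>Random sets revealed one at a time and in two rounds\<close>

primrec random_sets :: "'a set \<Rightarrow> nat \<Rightarrow> nat \<Rightarrow> 'a set set pmf" where
  "random_sets V l 0 = return_pmf {}"
| "random_sets V l (Suc m) =
     bind_pmf (pmf_of_set (ksubs V l)) (\<lambda>S. map_pmf (insert S) (random_sets V l m))"

text \<open>Colourability sees only which sets were drawn, so a tuple is reduced to its range. Index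
  \<open>m\<close> is independent of the earlier ones, which yields the recursion and makes every
  induction on the number of draws a one-step argument.\<close>

lemma map_random_tuples:
  "map_pmf (\<lambda>R. R ` {..<m}) (random_tuples V l m) = random_sets V l m"
proof (induction m)
  case 0
  then show ?case by (simp add: random_tuples_def)
next
  case (Suc m)
  have *: "(f(m := y)) ` {..<Suc m} = insert y (f ` {..<m})" for f :: "nat \<Rightarrow> 'a set" and y
    by (auto simp: lessThan_Suc)
  have "random_tuples V l (Suc m) =
      bind_pmf (pmf_of_set (ksubs V l)) (\<lambda>S. map_pmf (\<lambda>f. f(m := S)) (random_tuples V l m))"
    unfolding random_tuples_def lessThan_Suc ksubs_def
    by (subst Pi_pmf_insert') (auto simp: map_pmf_def)
  then show ?case
    unfolding random_sets.simps by (simp only: map_bind_pmf map_pmf_comp * flip: Suc.IH)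
qed

text \<open>Basis of two-round exposure: \<open>b\<close> fresh draws are independent of what the
  first \<open>a\<close> revealed.\<close>

lemma random_sets_add:
  "random_sets V l (a + b) =
     bind_pmf (random_sets V l a) (\<lambda>A. map_pmf (\<lambda>B. A \<union> B) (random_sets V l b))"
proof (induction a)
  case 0
  have "(\<union>) {} = (\<lambda>B :: 'a set set. B)" by auto
  then show ?case by (simp add: bind_return_pmf)
next
  case (Suc a)
  have "(\<union>) (insert S A) = (\<lambda>B. insert S (A \<union> B))" for S :: "'a set" and A by auto
  with Suc show ?case
    by (simp add: bind_assoc_pmf map_bind_pmf bind_map_pmf map_pmf_comp)
qed

lemma set_random_sets:
  assumes "finite V" "l \<le> card V" "R \<in> set_pmf (random_sets V l m)"
  shows "R \<subseteq> ksubs V l"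
proof -
  have "ksubs V l \<noteq> {}"
    using assms card_ksubs[of V l] by (metis binomial_eq_0_iff card.empty not_le)
  then have "set_pmf (pmf_of_set (ksubs V l)) = ksubs V l"
    using assms by (simp add: set_pmf_of_set)
  with assms(3) show ?thesis
    by (induction m arbitrary: R) auto
qed

abbreviation rprob :: "'a set \<Rightarrow> nat \<Rightarrow> nat \<Rightarrow> ('a set set \<Rightarrow> bool) \<Rightarrow> real" where
  "rprob V l m Q \<equiv> measure_pmf.prob (random_sets V l m) {R. Q R}"

lemma measure_bind_pmf:
  "measure_pmf.prob (bind_pmf M f) X = measure_pmf.expectation M (\<lambda>x. measure_pmf.prob (f x) X)"
proof -
  have "ennreal (measure_pmf.prob (bind_pmf M f) X) = (\<integral>\<^sup>+x. ennreal (measure_pmf.prob (f x) X) \<partial>M)"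
    by (simp flip: measure_pmf.emeasure_eq_measure)
  also have "\<dots> = ennreal (measure_pmf.expectation M (\<lambda>x. measure_pmf.prob (f x) X))"
    by (intro nn_integral_eq_integral measure_pmf.integrable_const_bound[where B = 1]) auto
  finally show ?thesis
    by (simp add: integral_nonneg_AE)
qed

lemma rprob_0: "rprob V l 0 Q = (if Q {} then 1 else 0)"
  by (simp add: indicator_def)

lemma rprob_Suc:
  assumes "finite V" "l \<le> card V"
  shows "rprob V l (Suc m) Q =
    (\<Sum>S\<in>ksubs V l. rprob V l m (\<lambda>R. Q (insert S R))) / real (card V choose l)"
proof -
  have "ksubs V l \<noteq> {}"
    using assms card_ksubs[of V l] by (metis binomial_eq_0_iff card.empty not_le)
  with assms show ?thesis
    by (simp add: measure_bind_pmf integral_pmf_of_set card_ksubs vimage_def)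
qed

text \<open>\<open>B\<close> is the bad event of the first round: on it the conditional probability
  is bounded by 1, off it by \<open>p\<close>. Every step that certifies sets first and exploits
  them afterwards goes through this bound.\<close>

lemma rprob_add_le:
  assumes "\<And>R. R \<in> set_pmf (random_sets V l a) \<Longrightarrow> \<not> B R \<Longrightarrow> rprob V l b (\<lambda>R'. Q (R \<union> R')) \<le> p" "0 \<le> p"
  shows "rprob V l (a + b) Q \<le> rprob V l a B + p"
proof -
  have "rprob V l (a + b) Q =
      measure_pmf.expectation (random_sets V l a) (\<lambda>R. rprob V l b (\<lambda>R'. Q (R \<union> R')))"
    by (simp add: random_sets_add measure_bind_pmf vimage_def)
  also have "\<dots> \<le> measure_pmf.expectation (random_sets V l a) (\<lambda>R. indicator {R. B R} R + p)"
    using assms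
    by (intro integral_mono_AE AE_pmfI measure_pmf.integrable_const_bound[where B = "1"]
          measure_pmf.integrable_const_bound[where B = "1 + p"])
       (auto simp: indicator_def intro: add_increasing2)
  also have "\<dots> = rprob V l a B + p"
    by (subst Bochner_Integration.integral_add) (auto simp: measure_pmf.emeasure_eq_measure)
  finally show ?thesis .
qed

lemma rprob_mono: "(\<And>R. P R \<Longrightarrow> Q R) \<Longrightarrow> rprob V l m P \<le> rprob V l m Q"
  by (intro measure_pmf.finite_measure_mono) auto

lemma rprob_Ex_le:
  assumes "finite I"
  shows "rprob V l m (\<lambda>R. \<exists>i\<in>I. P i R) \<le> (\<Sum>i\<in>I. rprob V l m (P i))"
proof -
  have "{R. \<exists>i\<in>I. P i R} = (\<Union>i\<in>I. {R. P i R})" by auto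
  then show ?thesis
    using measure_pmf.finite_measure_subadditive_finite[OF assms, of "\<lambda>i. {R. P i R}"] by simp
qed

text \<open>Markov's inequality for the number of surviving indices. A union bound over
  \<open>I\<close> would be too weak later; asking for a substantial proportion of survivors is
  affordable.\<close>

lemma rprob_card_Markov:
  assumes "finite I" and "\<And>i. i \<in> I \<Longrightarrow> rprob V l m (P i) \<le> b" and "0 < t"
  shows "rprob V l m (\<lambda>R. t \<le> real (card {i \<in> I. P i R})) \<le> real (card I) * b / t"
proof -
  let ?f = "\<lambda>R. \<Sum>i\<in>I. indicator {R. P i R} R :: real"
  have card: "real (card {i \<in> I. P i R}) = ?f R" for R
    using assms(1) by (simp add: indicator_def sum.If_cases Int_def)
  have int: "integrable (measure_pmf (random_sets V l m)) (\<lambda>R. indicator {R. P i R} R :: real)" for i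
    by (intro measure_pmf.integrable_const_bound[where B = 1]) (auto simp: indicator_def)
  have "rprob V l m (\<lambda>R. t \<le> ?f R) \<le> measure_pmf.expectation (random_sets V l m) ?f / t"
    using integral_Markov_inequality_measure[of "measure_pmf (random_sets V l m)" ?f "{}" t] int assms(3)
    by (auto intro!: sum_nonneg)
  also have "measure_pmf.expectation (random_sets V l m) ?f = (\<Sum>i\<in>I. rprob V l m (P i))"
    by (subst Bochner_Integration.integral_sum) (auto intro: int)
  also have "\<dots> \<le> real (card I) * b"
    using sum_bounded_above[of I "\<lambda>i. rprob V l m (P i)" b] assms(2) by simp
  finally show ?thesis
    using assms(3) by (simp add: card divide_right_mono)
qed

text \<open>By \<open>choose_ratio_ge\<close> each draw falls inside \<open>X\<close> with
  probability at least \<open>(card X / (2 * card V)) ^ l\<close>, independently of the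
  others.\<close>

lemma rprob_none_contained:
  assumes "finite V" "l \<le> card V" "X \<subseteq> V" "2 * l \<le> card X" "0 < l"
  shows "rprob V l m (\<lambda>R. \<forall>r\<in>R. \<not> r \<subseteq> X) \<le> exp (- real m * (real (card X) / (2 * real (card V))) ^ l)"
proof -
  define n where "n = real (card V choose l)"
  define s where "s = (real (card X) / (2 * real (card V))) ^ l"
  have n: "n > 0" using assms(2) by (simp add: n_def)
  have fX: "finite X" using assms finite_subset by blast
  have V: "0 < card V" using assms by linarith
  have "card X \<le> card V" by (simp add: assms card_mono)
  then have "real (card X) / (2 * real (card V)) \<le> 1"
    using V by (simp add: divide_simps)
  then have s1: "s \<le> 1" "0 \<le> s"
    unfolding s_def by (auto intro: power_le_one)
  have X: "ksubs X l \<subseteq> ksubs V l" using assms by (auto simp: ksubs_def)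
  have "rprob V l m (\<lambda>R. \<forall>r\<in>R. \<not> r \<subseteq> X) \<le> (1 - s) ^ m"
  proof (induction m)
    case 0
    then show ?case by (simp only: rprob_0) simp
  next
    case (Suc m)
    let ?p = "rprob V l m (\<lambda>R. \<forall>r\<in>R. \<not> r \<subseteq> X)"
    have "rprob V l m (\<lambda>R. \<forall>r\<in>insert S R. \<not> r \<subseteq> X) = (if S \<subseteq> X then 0 else ?p)" for S
      by simp
    then have "(\<Sum>S\<in>ksubs V l. rprob V l m (\<lambda>R. \<forall>r\<in>insert S R. \<not> r \<subseteq> X)) =
       (\<Sum>S\<in>ksubs V l. if S \<subseteq> X then 0 else ?p)"
      by (simp only:)
    also have "\<dots> = (\<Sum>S\<in>ksubs V l - ksubs X l. ?p)"
      using assms(1) by (intro sum.mono_neutral_cong_right) (auto simp: ksubs_def)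
    also have "\<dots> = (n - real (card X choose l)) * ?p"
      using assms fX X by (simp add: card_Diff_subset card_ksubs n_def of_nat_diff card_mono
         card_mono[OF _ X, simplified card_ksubs[OF assms(1)] card_ksubs[OF fX] finite_ksubs[OF assms(1)]])
    also have "\<dots> \<le> (n - s * n) * (1 - s) ^ m"
      using choose_ratio_ge[of l "card X" "card V"] assms V s1 n Suc.IH
      by (intro mult_mono) (auto simp: s_def n_def intro!: mult_left_le_one_le)
    also have "\<dots> = n * (1 - s) ^ Suc m" by (simp add: algebra_simps)
    finally show ?case
      unfolding rprob_Suc[OF assms(1,2)] using n by (simp add: n_def field_simps)
  qed
  also have "\<dots> \<le> exp (- s) ^ m"
    using s1 exp_ge_add_one_self[of "-s"] by (intro power_mono) auto
  also have "\<dots> = exp (- real m * s)"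
    by (simp flip: exp_of_nat_mult)
  finally show ?thesis by (simp add: s_def)
qed

section \<open>One-sided families\<close>

text \<open>The link of \<open>S\<close> in \<open>H\<close>, for \<open>S\<close> of any
  size.\<close>

definition nbrs :: "'a set set \<Rightarrow> 'a set \<Rightarrow> 'a set set" where
  "nbrs H S = {T. T \<inter> S = {} \<and> T \<union> S \<in> H}"

lemma nbrs_subset_ksubs:
  assumes "finite V" "H \<subseteq> ksubs V k" "S \<in> ksubs V a"
  shows "nbrs H S \<subseteq> ksubs V (k - a)"
proof
  fix T assume "T \<in> nbrs H S"
  then have *: "T \<inter> S = {}" "T \<union> S \<in> ksubs V k"
    using assms by (auto simp: nbrs_def)
  then have "finite T" "finite S" "card (T \<union> S) = k" "T \<subseteq> V"
    using assms by (auto simp: ksubs_def intro: finite_subset)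
  then show "T \<in> ksubs V (k - a)"
    using * assms by (auto simp: ksubs_def card_Un_disjoint)
qed

lemma finite_nbrs:
  assumes "finite V" "H \<subseteq> ksubs V k"
  shows "finite (nbrs H S)"
proof -
  have "nbrs H S \<subseteq> Pow V"
    using assms by (auto simp: nbrs_def ksubs_def)
  then show ?thesis using assms finite_subset by blast
qed

lemma nbrs_mono: "H \<subseteq> H' \<Longrightarrow> nbrs H S \<subseteq> nbrs H' S"
  by (auto simp: nbrs_def)

lemma nbrs_commute: "T \<in> nbrs H S \<longleftrightarrow> S \<in> nbrs H T"
  by (auto simp: nbrs_def Un_commute Int_commute)

text \<open>Double counting of pairs (edge, \<open>a\<close>-subset of it): the pair
  \<open>(S, T)\<close> with \<open>T\<close> in the link of \<open>S\<close> corresponds to the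
  edge \<open>T \<union> S\<close> with marked part \<open>S\<close>.\<close>

lemma sum_card_nbrs:
  assumes "finite V" "H \<subseteq> ksubs V k"
  shows "(\<Sum>S\<in>ksubs V a. card (nbrs H S)) = (k choose a) * card H"
proof -
  have fH: "finite H" using assms finite_subset by fastforce
  have fe: "finite e" "card e = k" "e \<subseteq> V" if "e \<in> H" for e
    using that assms by (auto simp: ksubs_def intro: finite_subset)
  have "(\<Sum>S\<in>ksubs V a. card (nbrs H S)) = card (Sigma (ksubs V a) (nbrs H))"
    using assms by (simp add: finite_nbrs)
  also have "\<dots> = card (Sigma H (\<lambda>e. ksubs e a))"
  proof (rule bij_betw_same_card)
    show "bij_betw (\<lambda>(S, T). (T \<union> S, S)) (Sigma (ksubs V a) (nbrs H)) (Sigma H (\<lambda>e. ksubs e a))"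
      by (rule bij_betwI[where g = "\<lambda>(e, S). (S, e - S)"])
         (use fe in \<open>force simp: nbrs_def ksubs_def Un_absorb1 Un_absorb2\<close>)+
  qed
  also have "\<dots> = (\<Sum>e\<in>H. card (ksubs e a))"
    using fe fH by simp
  also have "\<dots> = (k choose a) * card H"
    using fe by (simp add: card_ksubs)
  finally show ?thesis .
qed

lemma ksubs_1: "ksubs V 1 = (\<lambda>v. {v}) ` V"
proof -
  have "card S = 1 \<longleftrightarrow> (\<exists>v. S = {v})" for S :: "'a set"
    by (metis card_1_singletonE is_singletonI is_singleton_altdef)
  then show ?thesis by (auto simp: ksubs_def)
qed

lemma sum_card_nbrs_singleton:
  assumes "finite V" "H \<subseteq> ksubs V k"
  shows "(\<Sum>v\<in>V. card (nbrs H {v})) = k * card H"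
proof -
  have "(\<Sum>v\<in>V. card (nbrs H {v})) = (\<Sum>S\<in>(\<lambda>v. {v}) ` V. card (nbrs H S))"
    by (subst sum.reindex) auto
  then show ?thesis
    using sum_card_nbrs[OF assms, of 1] unfolding ksubs_1 by simp
qed

section \<open>Colourings and the one-sided estimate\<close>

definition colorable :: "'a set \<Rightarrow> 'a set set \<Rightarrow> bool" where
  "colorable V E \<longleftrightarrow> (\<exists>A\<subseteq>V. \<forall>e\<in>E. \<not> e \<subseteq> A \<and> \<not> e \<subseteq> V - A)"

text \<open>The half of the colouring conditions that survives passing to links: \<open>F\<close>
  constrains only the class \<open>A\<close>, and \<open>R\<close> only the complement.\<close>

definition evadable :: "'a set \<Rightarrow> 'a set set \<Rightarrow> 'a set set \<Rightarrow> bool" where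
  "evadable V F R \<longleftrightarrow> (\<exists>A\<subseteq>V. (\<forall>f\<in>F. \<not> f \<subseteq> A) \<and> (\<forall>r\<in>R. \<not> r \<subseteq> V - A))"

lemma colorable_antimono: "E \<subseteq> E' \<Longrightarrow> colorable V E' \<Longrightarrow> colorable V E"
  unfolding colorable_def by (meson subsetD)

text \<open>The upper and lower halves of \<open>m\<close>. The factor 3 is forced by
  \<open>m = 3\<close>, where the lower half is 1.\<close>

lemma halves:
  assumes "1 < m"
  obtains a b :: nat where "m = a + b" "real m \<le> 2 * real a" "real m \<le> 3 * real b"
proof
  show "m = (m - m div 2) + m div 2" by simp
  have "m \<le> 2 * (m - m div 2)" "m \<le> 3 * (m div 2)" using assms by presburger+
  then show "real m \<le> 2 * real (m - m div 2)" "real m \<le> 3 * real (m div 2)"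
    unfolding of_nat_le_iff[where 'a = real, symmetric] by simp_all
qed

text \<open>Passing to a link lowers the uniformity by one and may halve the density, so the lower
  bound on \<open>y * card V\<close> carries one factor 2 per level; it guarantees at least
  \<open>2 * l\<close> vertices of large degree. The constants depend only on \<open>l\<close> and
  \<open>j\<close>.\<close>

lemma rprob_evadable:
  fixes l :: nat
  assumes l: "0 < l"
  shows "\<exists>C c. 0 < c \<and> 1 \<le> C \<and>
     (\<forall>(V :: 'a set) F y m. finite V \<longrightarrow> F \<subseteq> ksubs V j \<longrightarrow> 0 < y \<longrightarrow> y * real (card V) ^ j \<le> real (card F)
        \<longrightarrow> 2 ^ (j + 1) * real l \<le> y * real (card V) \<longrightarrow> rprob V l m (evadable V F) \<le> C * exp (- c * real m * y ^ l))"
    (is "\<exists>C c. _ \<and> _ \<and> ?P C c j")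
proof (induction j)
  case 0
  \<comment> \<open>A nonempty 0-uniform family consists of the empty set, which lies in every
    class, so evasion is impossible.\<close>
  have "?P 1 1 0"
  proof (intro allI impI)
    fix V :: "'a set" and F y m
    assume F: "F \<subseteq> ksubs V 0" "finite V" and y: "0 < y" "y * real (card V) ^ 0 \<le> real (card F)"
    have "F \<noteq> {}" using y by auto
    moreover have "e = {}" if "e \<in> F" for e
      using F that ksubs_finite_elem[of V e 0] by (auto simp: ksubs_def)
    ultimately have "{} \<in> F" by blast
    then have "\<not> evadable V F R" for R by (auto simp: evadable_def)
    then show "rprob V l m (evadable V F) \<le> 1 * exp (- 1 * real m * y ^ l)" by simp
  qed
  then show ?case by (intro exI[of _ 1]) auto
next
  case (Suc j)
  then obtain C c where C: "0 < c" "1 \<le> C" "?P C c j" by blast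
  \<comment> \<open>In the first term, 2 comes from \<open>a \<ge> m / 2\<close> and
    \<open>4 ^ l\<close> from \<open>card X / (2 * n) \<ge> y / 4\<close>; in the second, 3 comes
    from \<open>b \<ge> m / 3\<close> and \<open>2 ^ l\<close> from the link density
    \<open>y / 2\<close>. In \<open>C'\<close>, \<open>exp c'\<close> makes the bound trivial for
    \<open>m \<le> 1\<close>, where the draws cannot be split, and \<open>1 + real l * C\<close>
    adds up the failures of the two rounds.\<close>
  define c' where "c' = min (1 / (2 * 4 ^ l)) (c / (3 * 2 ^ l))"
  define C' where "C' = exp c' + 1 + real l * C"
  have c': "0 < c'" "c' * 2 \<le> 1 / 4 ^ l" "c' * 3 \<le> c / 2 ^ l"
    using C by (auto simp: c'_def min_def field_simps)
  have C': "1 \<le> C'" "exp c' \<le> C'" "1 + real l * C \<le> C'"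
    using C c' by (auto simp: C'_def intro: add_increasing2)
  have "?P C' c' (Suc j)"
  proof (intro allI impI)
    fix V :: "'a set" and F y m
    assume V: "finite V" and F: "F \<subseteq> ksubs V (Suc j)" and y: "0 < y" 
      and Fy: "y * real (card V) ^ Suc j \<le> real (card F)"
      and yV: "2 ^ (Suc j + 1) * real l \<le> y * real (card V)"
    define n where "n = real (card V)"
    have "0 < 2 ^ (Suc j + 1) * real l" using l by simp
    then have "0 < y * n" using yV unfolding n_def by linarith
    then have n0: "n > 0" using y by (simp add: zero_less_mult_iff)
    have "card F \<le> card V ^ Suc j"
      using card_mono[OF _ F] card_ksubs_le[OF V, of "Suc j"] V by simp
    then have "real (card F) \<le> 1 * n ^ Suc j" unfolding n_def by (simp flip: of_nat_power of_nat_mult)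
    with Fy have "y * n ^ Suc j \<le> 1 * n ^ Suc j" by (simp add: n_def)
    then have y1: "y \<le> 1" using n0 by (metis mult_le_cancel_right_pos zero_less_power)
    show "rprob V l m (evadable V F) \<le> C' * exp (- c' * real m * y ^ l)"
    proof (cases "m \<le> 1")
      case True
      have "real m * y ^ l \<le> 1 * 1"
        using True y y1 by (intro mult_mono power_le_one) auto
      then have "c' * (real m * y ^ l) \<le> c' * 1"
        using c' by (intro mult_left_mono) auto
      then have "1 \<le> exp c' * exp (- c' * real m * y ^ l)"
        by (simp flip: exp_add add: mult.assoc)
      also have "\<dots> \<le> C' * exp (- c' * real m * y ^ l)"
        using C' by (intro mult_right_mono) auto
      finally show ?thesis by (meson measure_pmf.prob_le_1 order_trans)
    next
      case False
      obtain a b where m: "m = a + b" and a: "real m \<le> 2 * real a" and b: "real m \<le> 3 * real b"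
        using halves[of m] False by auto
      \<comment> \<open>Vertices outside \<open>X\<close> contribute at most half of
        \<open>y * n ^ Suc j\<close> to the degree sum, and each vertex of \<open>X\<close> at most
        \<open>n ^ j\<close>; hence \<open>X\<close> has at least \<open>y / 2 * n\<close>
        elements.\<close>
      define X where "X = {v\<in>V. (y / 2) * n ^ j \<le> real (card (nbrs F {v}))}"
      have X: "X \<subseteq> V" "finite X" using V by (auto simp: X_def)
      have nb: "nbrs F {v} \<subseteq> ksubs V j" if "v \<in> V" for v
        using nbrs_subset_ksubs[OF V F, of "{v}" 1] that by (simp add: ksubs_def)
      have dmax: "real (card (nbrs F {v})) \<le> n ^ j" if "v \<in> V" for v
      proof -
        have "card (nbrs F {v}) \<le> card V ^ j"
          using card_mono[OF _ nb[OF that]] card_ksubs_le[OF V, of j] V by simp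
        then show ?thesis by (simp add: n_def flip: of_nat_power)
      qed
      have "y * n ^ Suc j \<le> real (Suc j * card F)"
        using Fy order_trans[of _ "real (card F)" "real (Suc j * card F)"] by (simp add: n_def)
      also have "\<dots> = (\<Sum>v\<in>V. real (card (nbrs F {v})))"
        by (simp only: sum_card_nbrs_singleton[OF V F, symmetric] of_nat_sum)
      also have "\<dots> \<le> (\<Sum>v\<in>V. (if v \<in> X then n ^ j else 0) + (y / 2) * n ^ j)"
        using dmax y n0 by (intro sum_mono) (auto simp: X_def intro: add_increasing2)
      also have "\<dots> = real (card X) * n ^ j + n * ((y / 2) * n ^ j)"
        using V X by (simp add: sum.distrib n_def flip: sum.inter_filter) (simp add: X_def)
      finally have "(y / 2 * n) * n ^ j \<le> real (card X) * n ^ j"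
        by (simp add: algebra_simps)
      then have cX: "y / 2 * n \<le> real (card X)" using n0 by simp
      have "2 * real l * 2 ^ j \<le> y / 2 * n" using yV by (simp add: n_def algebra_simps)
      moreover have "2 * real l * 1 \<le> 2 * real l * 2 ^ j" by (intro mult_left_mono) auto
      ultimately have "2 * real l \<le> real (card X)" using cX by linarith
      then have lX: "2 * l \<le> card X" by linarith
      have lV: "l \<le> card V" using lX card_mono[OF V X(1)] by linarith
      \<comment> \<open>Which vertex of the tuple lies in \<open>A\<close> depends on a colouring
        not yet fixed, so all \<open>l\<close> of them are paid for.\<close>
      let ?p = "real l * (C * exp (- c * real b * (y / 2) ^ l))"
      have "rprob V l (a + b) (evadable V F) \<le> rprob V l a (\<lambda>R. \<forall>r\<in>R. \<not> r \<subseteq> X) + ?p"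
      proof (rule rprob_add_le)
        fix R assume R: "R \<in> set_pmf (random_sets V l a)" and "\<not> (\<forall>r\<in>R. \<not> r \<subseteq> X)"
        show "rprob V l b (\<lambda>R'. evadable V F (R \<union> R')) \<le> ?p"
        proof -
          obtain r where r: "r \<in> R" "r \<subseteq> X" using \<open>\<not> (\<forall>r\<in>R. \<not> r \<subseteq> X)\<close> by blast
          have rV: "r \<subseteq> V" "card r = l" "finite r"
            using set_random_sets[OF V lV R] r V by (auto simp: ksubs_def intro: finite_subset)
          have "rprob V l b (\<lambda>R'. evadable V F (R \<union> R')) \<le> rprob V l b (\<lambda>R'. \<exists>v\<in>r. evadable V (nbrs F {v}) R')"
          proof (rule rprob_mono)
            fix R' assume "evadable V F (R \<union> R')"
            then obtain A where A: "A \<subseteq> V" "\<forall>f\<in>F. \<not> f \<subseteq> A" "\<forall>r\<in>R \<union> R'. \<not> r \<subseteq> V - A"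
              by (auto simp: evadable_def)
            then obtain v where v: "v \<in> r" "v \<in> A" using r rV by blast
            have "\<forall>f\<in>nbrs F {v}. \<not> f \<subseteq> A"
              using A(2) v by (auto simp: nbrs_def)
            then show "\<exists>v\<in>r. evadable V (nbrs F {v}) R'"
              using A v unfolding evadable_def by blast
          qed
          also have "\<dots> \<le> (\<Sum>v\<in>r. rprob V l b (evadable V (nbrs F {v})))"
            by (rule rprob_Ex_le) (rule rV)
          also have "\<dots> \<le> (\<Sum>v\<in>r. C * exp (- c * real b * (y / 2) ^ l))"
          proof (rule sum_mono)
            fix v assume v: "v \<in> r"
            then have "v \<in> X" "v \<in> V" using r X by auto
            then show "rprob V l b (evadable V (nbrs F {v})) \<le> C * exp (- c * real b * (y / 2) ^ l)"
              using C(3)[rule_format, OF V nb[of v], of "y / 2"] y yV by (simp add: X_def n_def)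
          qed
          finally show ?thesis using rV by simp
        qed
      qed (use C in auto)
      also have "rprob V l a (\<lambda>R. \<forall>r\<in>R. \<not> r \<subseteq> X) \<le> exp (- c' * real m * y ^ l)"
      proof -
        have "c' * real m * y ^ l \<le> c' * (2 * real a) * y ^ l"
          using a c' y by (intro mult_right_mono mult_left_mono) auto
        also have "\<dots> \<le> (1 / 4 ^ l) * real a * y ^ l"
          using c'(2) y by (simp only: mult.assoc[symmetric]) (intro mult_right_mono, auto)
        also have "\<dots> = real a * (y / 4) ^ l" by (simp add: power_divide)
        also have "\<dots> \<le> real a * (real (card X) / (2 * real (card V))) ^ l"
          using cX n0 y by (intro mult_left_mono power_mono) (auto simp: n_def field_simps)
        finally have "exp (- real a * (real (card X) / (2 * real (card V))) ^ l) \<le> exp (- c' * real m * y ^ l)"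
          by simp
        then show ?thesis
          using rprob_none_contained[OF V lV X(1) lX l, of a] by linarith
      qed
      also have "?p \<le> real l * (C * exp (- c' * real m * y ^ l))"
      proof -
        have "c' * real m * y ^ l \<le> c' * (3 * real b) * y ^ l"
          using b c' y by (intro mult_right_mono mult_left_mono) auto
        also have "\<dots> \<le> (c / 2 ^ l) * real b * y ^ l"
          using c'(3) y by (simp only: mult.assoc[symmetric]) (intro mult_right_mono, auto)
        also have "\<dots> = c * real b * (y / 2) ^ l" by (simp add: power_divide)
        finally show ?thesis using C by (intro mult_left_mono) auto
      qed
      also have "exp (- c' * real m * y ^ l) + real l * (C * exp (- c' * real m * y ^ l)) =
          (1 + real l * C) * exp (- c' * real m * y ^ l)" by (simp add: algebra_simps)
      also have "\<dots> \<le> C' * exp (- c' * real m * y ^ l)"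
        using C' by (intro mult_right_mono) auto
      finally show ?thesis by (simp add: m)
    qed
  qed
  then show ?case using C' c' by blast
qed

section \<open>Random pairs\<close>

text \<open>With \<open>z = min x 1\<close>,
  \<open>exp (- z) \<le> 1 / (1 + z) \<le> 1 - z / 2\<close>. It makes an exponential potential
  linear in the capped gain, so that the gain can be averaged over the next pair.\<close>

lemma exp_minus_le_min: 
  fixes x :: real assumes "0 \<le> x" shows "exp (- x) \<le> 1 - min x 1 / 2"
proof -
  define z where "z = min x 1"
  have z: "0 \<le> z" "z \<le> 1" "z \<le> x" using assms by (auto simp: z_def)
  have "exp (- x) \<le> exp (- z)" using z by simp
  also have "\<dots> \<le> 1 / (1 + z)"
    using exp_ge_add_one_self[of z] z by (simp add: exp_minus field_simps)
  also have "\<dots> \<le> 1 - z / 2"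
    using z mult_left_le[of z z] by (simp add: field_simps)
  finally show ?thesis by (simp add: z_def)
qed

section \<open>Sets certified by random pairs, for \<open>l = 2\<close>\<close>

definition deg :: "'a set set \<Rightarrow> 'a \<Rightarrow> nat" where
  "deg H v = card (nbrs H {v})"

text \<open>The set \<open>M(T)\<close> of the header.\<close>

definition low_ext :: "'a set set \<Rightarrow> 'a set \<Rightarrow> 'a set" where
  "low_ext H T = {u. u \<notin> T \<and> insert u T \<in> H \<and> (\<forall>x\<in>T. deg H u \<le> deg H x)}"

lemma low_ext_subset: "H \<subseteq> ksubs V k \<Longrightarrow> low_ext H T \<subseteq> V"
  by (auto simp: low_ext_def ksubs_def)

text \<open>Removing a vertex of minimum degree from an edge leaves a set \<open>T\<close> that has
  this vertex in \<open>low_ext H T\<close>.\<close>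

lemma card_le_sum_low_ext:
  assumes "finite V" "H \<subseteq> ksubs V k" "1 \<le> k"
  shows "card H \<le> (\<Sum>T\<in>ksubs V (k - 1). card (low_ext H T))"
proof -
  have fin: "finite (low_ext H T)" for T
    using low_ext_subset[OF assms(2)] assms(1) finite_subset by blast
  have "H \<subseteq> (\<lambda>(T, u). insert u T) ` Sigma (ksubs V (k - 1)) (low_ext H)"
  proof
    fix e assume e: "e \<in> H"
    then have ek: "e \<in> ksubs V k" using assms by blast
    then have fe: "finite e" "card e = k" "e \<subseteq> V"
      using ksubs_finite_elem[OF assms(1) ek] ek by (auto simp: ksubs_def)
    then have "e \<noteq> {}" using assms(3) by auto
    then obtain u where u: "u \<in> e" "\<forall>x\<in>e. deg H u \<le> deg H x"
      using ex_min_if_finite[of "deg H ` e"] fe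
      by (metis (no_types, lifting) arg_min_if_finite(1) arg_min_least)
    then have "e - {u} \<in> ksubs V (k - 1)" "u \<in> low_ext H (e - {u})" "e = insert u (e - {u})"
      using fe e by (auto simp: ksubs_def low_ext_def insert_absorb)
    then show "e \<in> (\<lambda>(T, u). insert u T) ` Sigma (ksubs V (k - 1)) (low_ext H)"
      by (intro image_eqI[of _ _ "(e - {u}, u)"]) auto
  qed
  then have "card H \<le> card (Sigma (ksubs V (k - 1)) (low_ext H))"
    using assms(1) fin by (intro surj_card_le) auto
  then show ?thesis using assms(1) fin by simp
qed

text \<open>Replace the degree of the chosen vertex by the sum over all vertices of
  \<open>T\<close>; a vertex lies in at most \<open>card V ^ (k - 2)\<close> of the sets, and the
  degrees sum to \<open>k * card H\<close>.\<close>

lemma sum_ksubs_deg_le: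
  assumes "finite V" "H \<subseteq> ksubs V k" "2 \<le> k" "\<And>T. T \<in> ksubs V (k - 1) \<Longrightarrow> x T \<in> T"
  shows "(\<Sum>T\<in>ksubs V (k - 1). deg H (x T)) \<le> k * card H * card V ^ (k - 2)"
proof -
  have "(\<Sum>T\<in>ksubs V (k - 1). deg H (x T)) \<le> (\<Sum>T\<in>ksubs V (k - 1). \<Sum>v\<in>V. if v \<in> T then deg H v else 0)"
  proof (rule sum_mono)
    fix T assume "T \<in> ksubs V (k - 1)"
    then have "x T \<in> V" "x T \<in> T" using assms(4)[of T] by (auto simp: ksubs_def)
    then show "deg H (x T) \<le> (\<Sum>v\<in>V. if v \<in> T then deg H v else 0)"
      using member_le_sum[of "x T" V "\<lambda>v. if v \<in> T then deg H v else 0"] assms(1) by simp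
  qed
  also have "\<dots> = (\<Sum>v\<in>V. \<Sum>T\<in>ksubs V (k - 1). if v \<in> T then deg H v else 0)"
    by (rule sum.swap)
  also have "\<dots> = (\<Sum>v\<in>V. deg H v * card {T\<in>ksubs V (k - 1). v \<in> T})"
    using assms(1) by (intro sum.cong) (auto simp flip: sum.inter_filter)
  also have "\<dots> \<le> (\<Sum>v\<in>V. deg H v * card V ^ (k - 2))"
  proof (intro sum_mono mult_left_mono)
    fix v
    have "card {T\<in>ksubs V (k - 1). v \<in> T} \<le> card (ksubs V (k - 2))"
    proof (rule card_inj_on_le[where f = "\<lambda>T. T - {v}"])
      show "inj_on (\<lambda>T. T - {v}) {T \<in> ksubs V (k - 1). v \<in> T}"
        by (rule inj_onI) (metis (no_types, lifting) insert_Diff mem_Collect_eq)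
      show "(\<lambda>T. T - {v}) ` {T \<in> ksubs V (k - 1). v \<in> T} \<subseteq> ksubs V (k - 2)"
        using assms(1) by (auto simp: ksubs_def numeral_2_eq_2 card_Diff_singleton)
    qed (use assms in simp)
    also have "\<dots> \<le> card V ^ (k - 2)" by (rule card_ksubs_le) fact
    finally show "card {T \<in> ksubs V (k - 1). v \<in> T} \<le> card V ^ (k - 2)" .
  qed simp
  also have "\<dots> = k * card H * card V ^ (k - 2)"
    using sum_card_nbrs_singleton[OF assms(1,2)] by (simp add: deg_def flip: sum_distrib_right)
  finally show ?thesis .
qed

text \<open>Passes from Cauchy-Schwarz sums over \<open>V \<times> V\<close> to the law of a random
  pair; the diagonal has to be paid for separately.\<close>

lemma sum_ordered_pairs:
  fixes f :: "'a set \<Rightarrow> real"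
  assumes "finite V"
  shows "(\<Sum>u\<in>V. \<Sum>v\<in>V. f {u, v}) = (\<Sum>u\<in>V. f {u}) + 2 * (\<Sum>S\<in>ksubs V 2. f S)"
proof -
  define P where "P = {z \<in> V \<times> V. fst z \<noteq> snd z}"
  have fP: "finite P" using assms by (simp add: P_def)
  have "(\<Sum>u\<in>V. \<Sum>v\<in>V. f {u, v}) = (\<Sum>z\<in>V \<times> V. f {fst z, snd z})"
    by (simp add: sum.cartesian_product case_prod_beta)
  also have "V \<times> V = (\<lambda>u. (u, u)) ` V \<union> P" by (auto simp: P_def)
  also have "(\<Sum>z\<in>(\<lambda>u. (u, u)) ` V \<union> P. f {fst z, snd z}) =
      (\<Sum>z\<in>(\<lambda>u. (u, u)) ` V. f {fst z, snd z}) + (\<Sum>z\<in>P. f {fst z, snd z})"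
    using assms fP by (intro sum.union_disjoint) (auto simp: P_def)
  also have "(\<Sum>z\<in>(\<lambda>u. (u, u)) ` V. f {fst z, snd z}) = (\<Sum>u\<in>V. f {u})"
    by (subst sum.reindex) (auto simp: inj_on_def)
  also have "(\<Sum>z\<in>P. f {fst z, snd z}) = (\<Sum>S\<in>ksubs V 2. \<Sum>z\<in>{z\<in>P. {fst z, snd z} = S}. f {fst z, snd z})"
    using assms fP by (intro sum.group[symmetric]) (auto simp: P_def ksubs_def)
  also have "\<dots> = (\<Sum>S\<in>ksubs V 2. 2 * f S)"
  proof (rule sum.cong)
    fix S assume "S \<in> ksubs V 2"
    then obtain a b where ab: "S = {a, b}" "a \<noteq> b" "a \<in> V" "b \<in> V"
      by (auto simp: ksubs_def card_2_iff)
    then have "{z\<in>P. {fst z, snd z} = S} = {(a, b), (b, a)}"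
      by (auto simp: P_def doubleton_eq_iff)
    then show "(\<Sum>z\<in>{z\<in>P. {fst z, snd z} = S}. f {fst z, snd z}) = 2 * f S"
      using ab by (simp add: insert_commute)
  qed simp
  finally show ?thesis by (simp add: sum_distrib_left)
qed

definition covered :: "'a set \<Rightarrow> nat \<Rightarrow> 'a set set \<Rightarrow> 'a set set \<Rightarrow> 'a set set" where
  "covered V j H R = {T \<in> ksubs V j. \<exists>r\<in>R. r \<subseteq> low_ext H T}"

lemma covered_subset: "covered V j H R \<subseteq> ksubs V j"
  by (auto simp: covered_def)

text \<open>If \<open>T\<close> lies in one class, every \<open>u\<close> of the certifying set
  \<open>r\<close> completes \<open>T\<close> to an edge and so lies in the other class; then
  \<open>r\<close> itself is monochromatic.\<close>

lemma colorable_covered: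
  assumes "colorable V (H \<union> (R \<union> R'))" "\<And>r. r \<in> R \<Longrightarrow> r \<noteq> {}" "H \<subseteq> ksubs V k"
  shows "colorable V (covered V j H R \<union> R')"
proof -
  obtain A where A: "A \<subseteq> V" "\<And>e. e \<in> H \<union> (R \<union> R') \<Longrightarrow> \<not> e \<subseteq> A \<and> \<not> e \<subseteq> V - A"
    using assms(1) by (auto simp: colorable_def)
  have "\<not> T \<subseteq> B" if T: "T \<in> covered V j H R" 
    and B: "B \<subseteq> V" "\<And>e. e \<in> H \<union> (R \<union> R') \<Longrightarrow> \<not> e \<subseteq> B \<and> \<not> e \<subseteq> V - B" for B T
  proof
    assume "T \<subseteq> B"
    obtain r where r: "r \<in> R" "r \<subseteq> low_ext H T" using T by (auto simp: covered_def)
    have "u \<in> V - B" if "u \<in> r" for u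
    proof -
      have u: "insert u T \<in> H" using r that by (auto simp: low_ext_def)
      then have "\<not> insert u T \<subseteq> B" using B by blast
      moreover have "u \<in> V" using u assms(3) by (auto simp: ksubs_def)
      ultimately show ?thesis using \<open>T \<subseteq> B\<close> by auto
    qed
    then have "r \<subseteq> V - B" by blast
    then show False using B(2)[of r] r by blast
  qed
  note * = this
  have "V - (V - A) = A" using A by auto
  then have "\<not> T \<subseteq> A \<and> \<not> T \<subseteq> V - A" if "T \<in> covered V j H R" for T
    using *[OF that, of A] *[OF that, of "V - A"] A by auto
  then show ?thesis
    unfolding colorable_def using A by (intro exI[of _ A]) blast
qed

text \<open>\<open>p\<close> is the exact density, because \<open>card H\<close> enters both as a
  lower bound (number of extensions) and as an upper bound (degree sum). The bound on
  \<open>p * n\<close> makes the diagonal pairs negligible.\<close>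

locale dense_family =
  fixes V :: "'a set" and H :: "'a set set" and k :: nat and n p N :: real
  assumes V: "finite V" and H: "H \<subseteq> ksubs V k" and k: "2 \<le> k"
    and n_def: "n = real (card V)" and N_def: "N = n ^ (k - 1)"
    and card_H: "real (card H) = p * n ^ k"
    and pn: "8 * real (k + 1) \<le> p * n"
begin

lemma n_pos: "0 < n" and p_pos: "0 < p" and N_pos: "0 < N" and p_le_1: "p \<le> 1"
proof -
  have "0 < p * n" using pn by (smt (verit) of_nat_0_le_iff of_nat_1 of_nat_add)
  moreover have "0 \<le> n" by (simp add: n_def)
  ultimately show n: "0 < n" and "0 < p" by (auto simp: zero_less_mult_iff)
  then show "0 < N" by (simp add: N_def)
  have "card H \<le> card V ^ k"
    using card_mono[OF _ H] card_ksubs_le[OF V, of k] V by simp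
  then have "real (card H) \<le> 1 * n ^ k" by (simp add: n_def flip: of_nat_power)
  then show "p \<le> 1" using n unfolding card_H by (metis mult_le_cancel_right_pos zero_less_power)
qed

lemma n_N: "n * N = n ^ k"
  using k by (simp add: N_def flip: power_Suc)

lemma finite_low_ext [simp]: "finite (low_ext H T)"
  using low_ext_subset[OF H] V finite_subset by blast

text \<open>The number of sets newly certified by drawing \<open>S\<close> when those in
  \<open>L\<close> already are.\<close>

definition gain :: "'a set set \<Rightarrow> 'a set \<Rightarrow> nat" where
  "gain L S = card {T \<in> ksubs V (k - 1) - L. S \<subseteq> low_ext H T}"

lemma gain_le_deg: "u \<in> S \<Longrightarrow> gain L S \<le> deg H u"
  unfolding gain_def deg_def
  by (rule card_mono[OF finite_nbrs[OF V H]]) (auto simp: nbrs_def low_ext_def)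

text \<open>Gains are capped at \<open>p * N\<close>, so that a few pairs certifying very many sets
  cannot account for the whole sum. Since the gain of a pair containing \<open>u\<close> is at most
  \<open>deg H u\<close>, the capped gain is at least \<open>gain / (deg u + p * N)\<close>. The
  degree condition in \<open>low_ext\<close> replaces \<open>deg u\<close> by the degree of a vertex
  of \<open>T\<close>, whose sum over all \<open>T\<close> is under control.\<close>

lemma sum_gain_ge:
  assumes L: "L \<subseteq> ksubs V (k - 1)" "real (card L) \<le> p * N / 2"
  shows "p * n\<^sup>2 / (4 * real (k + 1)) \<le> (\<Sum>u\<in>V. \<Sum>v\<in>V. min (real (gain L {u, v}) / (p * N)) 1)"
proof -
  let ?K = "ksubs V (k - 1)"
  let ?M = "\<lambda>T. real (card (low_ext H T))"
  define x :: "'a set \<Rightarrow> 'a" where "x T = (SOME v. v \<in> T)" for T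
  have x: "x T \<in> T" if "T \<in> ?K" for T
  proof -
    have "T \<noteq> {}" using that k by (auto simp: ksubs_def)
    then show ?thesis unfolding x_def by (simp add: some_in_eq)
  qed
  \<comment> \<open>\<open>x T\<close> is an arbitrary vertex of \<open>T\<close>. As
    \<open>deg H u \<le> deg H (x T)\<close> for all \<open>u\<close> in \<open>low_ext H T\<close>,
    one weight dominates all denominators \<open>deg u + p * N\<close> belonging to
    \<open>T\<close>.\<close>
  define w where "w T = real (deg H (x T)) + p * N" for T
  have pN: "0 < p * N" using p_pos N_pos by simp
  have w: "0 < w T" for T using pN by (simp add: w_def add_nonneg_pos)
  have fL: "finite L" using L V finite_subset by fastforce
  have fK: "finite ?K" using V by simp
  have Mn: "?M T \<le> n" for T
    unfolding n_def using low_ext_subset[OF H] V by (simp add: card_mono)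
  \<comment> \<open>Each member of \<open>L\<close> accounts for at most \<open>n\<close>
    extensions, so leaving out \<open>L\<close> costs at most half of the total.\<close>
  have "p * n ^ k \<le> (\<Sum>T\<in>?K. ?M T)"
    using card_le_sum_low_ext[OF V H] k by (simp flip: card_H of_nat_sum)
  also have "\<dots> = (\<Sum>T\<in>?K - L. ?M T) + (\<Sum>T\<in>L. ?M T)"
    using L fK by (simp add: sum.subset_diff)
  also have "(\<Sum>T\<in>L. ?M T) \<le> real (card L) * n"
    using sum_bounded_above[of L ?M n] Mn by simp
  also have "\<dots> \<le> p * N / 2 * n" using L n_pos by (intro mult_right_mono) auto
  also have "\<dots> = p * n ^ k / 2" by (simp flip: n_N)
  finally have half: "p * n ^ k / 2 \<le> (\<Sum>T\<in>?K - L. ?M T)" by simp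
  have "(\<Sum>T\<in>?K - L. w T) \<le> (\<Sum>T\<in>?K. w T)"
    using fK w by (intro sum_mono2) (auto intro: less_imp_le)
  also have "\<dots> = real (\<Sum>T\<in>?K. deg H (x T)) + real (card ?K) * (p * N)"
    by (simp add: w_def sum.distrib)
  also have "\<dots> \<le> real (k * card H * card V ^ (k - 2)) + N * (p * N)"
  proof (intro add_mono mult_right_mono)
    show "real (\<Sum>T\<in>?K. deg H (x T)) \<le> real (k * card H * card V ^ (k - 2))"
      unfolding of_nat_le_iff by (rule sum_ksubs_deg_le[OF V H k x])
    show "real (card ?K) \<le> N"
      using card_ksubs_le[OF V, of "k - 1"] by (simp add: N_def n_def flip: of_nat_power)
  qed (use pN in simp)
  also have "real (k * card H * card V ^ (k - 2)) = real k * p * (n ^ k * n ^ (k - 2))"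
    by (simp add: card_H n_def)
  also have "n ^ k * n ^ (k - 2) = N * N"
    using k by (simp add: N_def flip: power_add) (simp add: numeral_2_eq_2)
  also have "real k * p * (N * N) + N * (p * N) = real (k + 1) * p * N\<^sup>2"
    by (simp add: algebra_simps power2_eq_square)
  finally have sw: "(\<Sum>T\<in>?K - L. w T) \<le> real (k + 1) * p * N\<^sup>2" .
  \<comment> \<open>Weighted Cauchy-Schwarz: the number of ordered pairs in
    \<open>low_ext H T\<close>, divided by \<open>w T\<close>, is bounded below on average because
    the weights sum to at most \<open>(k + 1) * p * N^2\<close>.\<close>
  have "(p * n ^ k / 2)\<^sup>2 \<le> (\<Sum>T\<in>?K - L. ?M T)\<^sup>2"
    using half p_pos n_pos by (intro power_mono) auto
  also have "(\<Sum>T\<in>?K - L. ?M T) = (\<Sum>T\<in>?K - L. (?M T / sqrt (w T)) * sqrt (w T))"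
    using w by (intro sum.cong) (auto simp: less_imp_neq[symmetric])
  also have "\<dots>\<^sup>2 \<le> (\<Sum>T\<in>?K - L. (?M T / sqrt (w T))\<^sup>2) * (\<Sum>T\<in>?K - L. (sqrt (w T))\<^sup>2)"
    by (rule Cauchy_Schwarz_ineq_sum)
  also have "\<dots> = (\<Sum>T\<in>?K - L. (?M T)\<^sup>2 / w T) * (\<Sum>T\<in>?K - L. w T)"
    using w by (simp add: power_divide less_imp_le)
  also have "\<dots> \<le> (\<Sum>T\<in>?K - L. (?M T)\<^sup>2 / w T) * (real (k + 1) * p * N\<^sup>2)"
    using w by (intro mult_left_mono sw sum_nonneg divide_nonneg_pos) auto
  also have "(p * n ^ k / 2)\<^sup>2 = (p * n\<^sup>2 / (4 * real (k + 1))) * (real (k + 1) * p * N\<^sup>2)"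
    by (simp add: power2_eq_square field_simps flip: n_N)
  finally have "p * n\<^sup>2 / (4 * real (k + 1)) \<le> (\<Sum>T\<in>?K - L. (?M T)\<^sup>2 / w T)"
    using p_pos N_pos by (subst (asm) mult_le_cancel_right_pos) auto
  also have "\<dots> \<le> (\<Sum>T\<in>?K - L. \<Sum>u\<in>low_ext H T. \<Sum>v\<in>low_ext H T. 1 / (real (deg H u) + p * N))"
  proof (rule sum_mono)
    fix T assume T: "T \<in> ?K - L"
    have "(?M T)\<^sup>2 / w T = (\<Sum>u\<in>low_ext H T. \<Sum>v\<in>low_ext H T. 1 / w T)"
      by (simp add: power2_eq_square)
    also have "\<dots> \<le> (\<Sum>u\<in>low_ext H T. \<Sum>v\<in>low_ext H T. 1 / (real (deg H u) + p * N))"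
    proof (intro sum_mono divide_left_mono)
      fix u assume "u \<in> low_ext H T"
      then have "deg H u \<le> deg H (x T)" using x T by (auto simp: low_ext_def)
      then show "real (deg H u) + p * N \<le> w T" by (simp add: w_def)
      show "0 < w T * (real (deg H u) + p * N)" using w pN by (simp add: add_nonneg_pos)
    qed simp
    finally show "(?M T)\<^sup>2 / w T \<le> (\<Sum>u\<in>low_ext H T. \<Sum>v\<in>low_ext H T. 1 / (real (deg H u) + p * N))" .
  qed
  also have "\<dots> = (\<Sum>T\<in>?K - L. \<Sum>u\<in>V. \<Sum>v\<in>V. if u \<in> low_ext H T \<and> v \<in> low_ext H T then 1 / (real (deg H u) + p * N) else 0)"
  proof (rule sum.cong[OF refl])
    fix T
    have "(\<Sum>v\<in>low_ext H T. c) = (\<Sum>v\<in>V. if v \<in> low_ext H T then c else 0)" for c :: real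
      using V low_ext_subset[OF H, of T] by (intro sum.mono_neutral_cong_left) auto
    moreover have "(\<Sum>u\<in>low_ext H T. f u) = (\<Sum>u\<in>V. if u \<in> low_ext H T then f u else 0)" for f :: "'a \<Rightarrow> real"
      using V low_ext_subset[OF H, of T] by (intro sum.mono_neutral_cong_left) auto
    ultimately show "(\<Sum>u\<in>low_ext H T. \<Sum>v\<in>low_ext H T. 1 / (real (deg H u) + p * N)) = 
      (\<Sum>u\<in>V. \<Sum>v\<in>V. if u \<in> low_ext H T \<and> v \<in> low_ext H T then 1 / (real (deg H u) + p * N) else 0)"
      by (simp only:) (intro sum.cong, auto)
  qed
  also have "\<dots> = (\<Sum>u\<in>V. \<Sum>T\<in>?K - L. \<Sum>v\<in>V. if u \<in> low_ext H T \<and> v \<in> low_ext H T then 1 / (real (deg H u) + p * N) else 0)"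
    by (rule sum.swap)
  also have "\<dots> = (\<Sum>u\<in>V. \<Sum>v\<in>V. \<Sum>T\<in>?K - L. if u \<in> low_ext H T \<and> v \<in> low_ext H T then 1 / (real (deg H u) + p * N) else 0)"
    by (intro sum.cong refl sum.swap)
  also have "\<dots> = (\<Sum>u\<in>V. \<Sum>v\<in>V. real (gain L {u, v}) / (real (deg H u) + p * N))"
    using fK by (intro sum.cong) (auto simp: gain_def simp flip: sum.inter_filter)
  \<comment> \<open>The summand \<open>p * N\<close> of the denominator gives the first bound, the
    summand \<open>deg u\<close> together with \<open>gain_le_deg\<close> the cap 1.\<close>
  also have "\<dots> \<le> (\<Sum>u\<in>V. \<Sum>v\<in>V. min (real (gain L {u, v}) / (p * N)) 1)"
  proof (intro sum_mono min.boundedI)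
    fix u v
    show "real (gain L {u, v}) / (real (deg H u) + p * N) \<le> real (gain L {u, v}) / (p * N)"
      using pN by (intro divide_left_mono) (auto simp: add_nonneg_pos)
    have "real (gain L {u, v}) \<le> real (deg H u) + p * N"
      using gain_le_deg[of u "{u, v}" L] pN by simp
    then show "real (gain L {u, v}) / (real (deg H u) + p * N) \<le> 1"
      using pN by (subst divide_le_eq_1_pos) (auto simp: add_nonneg_pos)
  qed
  finally show ?thesis .
qed

text \<open>A random pair has expected capped gain at least \<open>p / (8 * (k + 1))\<close>. The
  diagonal contributes at most \<open>n\<close>, which by \<open>8 * (k + 1) \<le> p * n\<close> is
  at most half of the bound in \<open>sum_gain_ge\<close>.\<close>

lemma sum_gain_pairs_ge:
  assumes "L \<subseteq> ksubs V (k - 1)" "real (card L) \<le> p * N / 2"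
  shows "p / (8 * real (k + 1)) * real (card V choose 2) \<le> (\<Sum>S\<in>ksubs V 2. min (real (gain L S) / (p * N)) 1)"
proof -
  let ?f = "\<lambda>S. min (real (gain L S) / (p * N)) 1"
  have "p * n\<^sup>2 / (4 * real (k + 1)) \<le> (\<Sum>u\<in>V. \<Sum>v\<in>V. ?f {u, v})"
    by (rule sum_gain_ge[OF assms])
  also have "\<dots> = (\<Sum>u\<in>V. ?f {u}) + 2 * (\<Sum>S\<in>ksubs V 2. ?f S)"
    by (rule sum_ordered_pairs[OF V])
  also have "(\<Sum>u\<in>V. ?f {u}) \<le> n"
    using sum_bounded_above[of V "\<lambda>u. ?f {u}" 1] by (simp add: n_def)
  also have "n \<le> p * n\<^sup>2 / (8 * real (k + 1))"
    using mult_right_mono[OF pn, of n] n_pos by (simp add: field_simps power2_eq_square)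
  finally have "p * n\<^sup>2 / (4 * real (k + 1)) \<le> p * n\<^sup>2 / (8 * real (k + 1)) + 2 * (\<Sum>S\<in>ksubs V 2. ?f S)"
    by simp
  moreover define D where "D = p * n\<^sup>2 / real (k + 1)"
  have D: "p * n\<^sup>2 / (c * real (k + 1)) = D / c" for c
    by (simp add: D_def)
  ultimately have "D / 4 \<le> D / 8 + 2 * (\<Sum>S\<in>ksubs V 2. ?f S)"
    by (simp only: D)
  then have "p * n\<^sup>2 / (16 * real (k + 1)) \<le> (\<Sum>S\<in>ksubs V 2. ?f S)"
    unfolding D by linarith
  moreover have "real (card V choose 2) \<le> n\<^sup>2 / 2"
  proof -
    have "2 * real (card V choose 2) = real ((card V choose 2) * fact 2)" by simp
    also have "\<dots> \<le> real (card V ^ 2)" unfolding of_nat_le_iff by (rule binomial_fact_pow)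
    finally show ?thesis by (simp add: n_def)
  qed
  then have "p / (8 * real (k + 1)) * real (card V choose 2) \<le> p / (8 * real (k + 1)) * (n\<^sup>2 / 2)"
    using p_pos by (intro mult_left_mono) auto
  moreover have "p / (8 * real (k + 1)) * (n\<^sup>2 / 2) = p * n\<^sup>2 / (16 * real (k + 1))" by simp
  ultimately show ?thesis by linarith
qed

text \<open>Potential argument with \<open>exp (- card L / (p * N))\<close>, where \<open>L\<close>
  holds the sets certified so far. While \<open>L\<close> is small, one more pair lowers the
  expected potential by the factor \<open>1 - p / (16 * (k + 1))\<close>. The summand
  \<open>1 / 2\<close> makes the bound at least 1 for \<open>m = 0\<close> whenever the event
  holds.\<close>

lemma rprob_covered_induct:
  assumes "L \<subseteq> ksubs V (k - 1)"
  shows "rprob V 2 m (\<lambda>R. real (card (L \<union> covered V (k - 1) H R)) \<le> p * N / 2)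
    \<le> exp (1 / 2 - real (card L) / (p * N)) * (1 - p / (16 * real (k + 1))) ^ m"
  using assms
proof (induction m arbitrary: L)
  case 0
  have "0 < p * N" using p_pos N_pos by simp
  moreover have "covered V (k - 1) H {} = {}" by (simp add: covered_def)
  ultimately show ?case
    by (simp only: rprob_0) (auto simp: field_simps)
next
  case (Suc m)
  let ?q = "1 - p / (16 * real (k + 1))"
  let ?f = "\<lambda>S. min (real (gain L S) / (p * N)) 1"
  let ?c = "\<lambda>R. covered V (k - 1) H R"
  have pN: "0 < p * N" using p_pos N_pos by simp
  have q: "0 \<le> ?q" using p_pos p_le_1 by (simp add: field_simps)
  have fK: "finite (ksubs V (k - 1))" using V by simp
  have fL: "finite L" using Suc.prems fK finite_subset by blast
  have c2: "2 \<le> card V"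
  proof -
    have "2 \<le> 8 * real (k + 1)" by simp
    also have "\<dots> \<le> p * n" by (rule pn)
    also have "\<dots> \<le> 1 * n" using p_le_1 n_pos by (intro mult_right_mono) auto
    finally show ?thesis by (simp add: n_def)
  qed
  define b where "b = real (card V choose 2)"
  have b: "0 < b" using c2 by (simp add: b_def)
  show ?case
  proof (cases "real (card L) \<le> p * N / 2")
    \<comment> \<open>Certified sets are never lost, so the event has become impossible.\<close>
    case False
    have "card L \<le> card (L \<union> ?c R)" for R
      using fL fK covered_subset[of V "k - 1" H R] finite_subset by (intro card_mono) auto
    then have "\<not> real (card (L \<union> ?c R)) \<le> p * N / 2" for R
      using False by (meson of_nat_mono order_trans)
    then show ?thesis using q by (simp only:) simp
  next
    case True
    have "rprob V 2 m (\<lambda>R. real (card (L \<union> ?c (insert S R))) \<le> p * N / 2) \<le>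
        exp (1 / 2 - real (card L) / (p * N)) * ?q ^ m * (1 - ?f S / 2)" for S
    proof -
      \<comment> \<open>The sets certified by the first pair are moved into \<open>L\<close>, which
        grows by exactly \<open>gain L S\<close>.\<close>
      have un: "L \<union> ?c (insert S R) = (L \<union> ?c {S}) \<union> ?c R" for R
        by (auto simp: covered_def)
      have sub: "L \<union> ?c {S} \<subseteq> ksubs V (k - 1)" using Suc.prems covered_subset by blast
      have "L \<union> ?c {S} = L \<union> {T \<in> ksubs V (k - 1) - L. S \<subseteq> low_ext H T}"
        by (auto simp: covered_def)
      moreover have "card (L \<union> {T \<in> ksubs V (k - 1) - L. S \<subseteq> low_ext H T}) = card L + gain L S"
        unfolding gain_def using fL fK by (intro card_Un_disjoint) auto
      ultimately have card: "card (L \<union> ?c {S}) = card L + gain L S" by simp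
      have "rprob V 2 m (\<lambda>R. real (card (L \<union> ?c (insert S R))) \<le> p * N / 2) \<le>
          rprob V 2 m (\<lambda>R. real (card ((L \<union> ?c {S}) \<union> ?c R)) \<le> p * N / 2)"
        by (rule rprob_mono) (simp only: un[symmetric])
      also have "\<dots> \<le> exp (1 / 2 - real (card L + gain L S) / (p * N)) * ?q ^ m"
        using Suc.IH[OF sub] by (simp only: card)
      also have "exp (1 / 2 - real (card L + gain L S) / (p * N)) =
          exp (1 / 2 - real (card L) / (p * N)) * exp (- (real (gain L S) / (p * N)))"
        by (simp add: add_divide_distrib flip: exp_add)
      also have "exp (- (real (gain L S) / (p * N))) \<le> 1 - ?f S / 2"
        using pN by (intro exp_minus_le_min) auto
      finally show ?thesis using q by (simp add: mult_ac mult_left_mono mult_right_mono)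
    qed
    then have "(\<Sum>S\<in>ksubs V 2. rprob V 2 m (\<lambda>R. real (card (L \<union> ?c (insert S R))) \<le> p * N / 2)) \<le>
       (\<Sum>S\<in>ksubs V 2. exp (1 / 2 - real (card L) / (p * N)) * ?q ^ m * (1 - ?f S / 2))"
      by (intro sum_mono)
    also have "\<dots> = exp (1 / 2 - real (card L) / (p * N)) * ?q ^ m * (b - (\<Sum>S\<in>ksubs V 2. ?f S) / 2)"
      by (simp add: sum_subtractf card_ksubs V b_def sum_divide_distrib flip: sum_distrib_left)
    also have "\<dots> \<le> exp (1 / 2 - real (card L) / (p * N)) * ?q ^ m * (b - (p / (8 * real (k + 1)) * b) / 2)"
      using sum_gain_pairs_ge[OF Suc.prems True] q unfolding b_def
      by (intro mult_left_mono diff_left_mono divide_right_mono) auto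
    also have "\<dots> = exp (1 / 2 - real (card L) / (p * N)) * ?q ^ Suc m * b"
      by (simp add: algebra_simps)
    finally show ?thesis
      unfolding rprob_Suc[OF V c2] using b by (simp add: b_def field_simps)
  qed
qed

lemma rprob_covered:
  "rprob V 2 m (\<lambda>R. real (card (covered V (k - 1) H R)) \<le> p * N / 2)
    \<le> 2 * exp (- (p * real m / (16 * real (k + 1))))"
proof -
  let ?x = "p / (16 * real (k + 1))"
  have x: "0 \<le> 1 - ?x" using p_pos p_le_1 by (simp add: field_simps)
  have "rprob V 2 m (\<lambda>R. real (card (covered V (k - 1) H R)) \<le> p * N / 2) \<le> exp (1 / 2) * (1 - ?x) ^ m"
    using rprob_covered_induct[of "{}" m] by simp
  also have "\<dots> \<le> 2 * exp (- ?x) ^ m"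
  proof (intro mult_mono power_mono)
    have "exp (1 / 2 :: real) ^ 2 \<le> 2 ^ 2" using exp_le by (simp flip: exp_of_nat_mult)
    then show "exp (1 / 2 :: real) \<le> 2" by (rule power2_le_imp_le) simp
    show "1 - ?x \<le> exp (- ?x)" using exp_ge_add_one_self[of "- ?x"] by simp
  qed (use x in auto)
  also have "exp (- ?x) ^ m = exp (- (p * real m / (16 * real (k + 1))))"
    by (simp add: mult_ac flip: exp_of_nat_mult)
  finally show ?thesis .
qed

end

section \<open>Families with small links\<close>

text \<open>Lists are built one set at a time. While the union \<open>U\<close> is smaller than
  \<open>Y\<close>, the sets of \<open>X\<close> overlap it in at most \<open>Y * B\<close>
  incidences altogether, so at most half of them meet \<open>U\<close> in more than
  \<open>\<theta> / 2\<close>; each of the others enlarges \<open>U\<close> by at least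
  \<open>\<theta> / 2\<close>. Thus every step keeps half of the choices.\<close>

lemma card_lists_large_union:
  fixes f :: "'b \<Rightarrow> 'c set" and \<theta> Y B :: real
  assumes X: "finite X" and f: "\<And>S. S \<in> X \<Longrightarrow> finite (f S)"
    and \<theta>: "0 < \<theta>" "\<And>S. S \<in> X \<Longrightarrow> \<theta> \<le> real (card (f S))"
    and B: "\<And>T. real (card {S\<in>X. T \<in> f S}) \<le> B"
    and Y: "Y * B \<le> \<theta> * real (card X) / 4"
  shows "(real (card X) / 2) ^ q \<le>
     real (card {xs. set xs \<subseteq> X \<and> length xs = q \<and> min Y (real q * \<theta> / 2) \<le> real (card (\<Union>S\<in>set xs. f S))})"
proof (induction q)
  case 0
  have "{xs. set xs \<subseteq> X \<and> length xs = 0 \<and> min Y (real 0 * \<theta> / 2) \<le> real (card (\<Union>S\<in>set xs. f S))} = {[]}"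
    by auto
  then show ?case by simp
next
  case (Suc q)
  let ?G = "\<lambda>q. {xs. set xs \<subseteq> X \<and> length xs = q \<and> min Y (real q * \<theta> / 2) \<le> real (card (\<Union>S\<in>set xs. f S))}"
  let ?ok = "\<lambda>xs. {S\<in>X. S # xs \<in> ?G (Suc q)}"
  have fG: "finite (?G q)" for q
    by (rule finite_subset[OF _ finite_lists_length_eq[OF X, of q]]) auto
  have B0: "0 \<le> B" using B[of undefined] by (meson of_nat_0_le_iff order_trans)
  have ok: "real (card X) / 2 \<le> real (card (?ok xs))" if xs: "xs \<in> ?G q" for xs
  proof -
    define U where "U = (\<Union>S\<in>set xs. f S)"
    have fU: "finite U" using xs f by (auto simp: U_def)
    show ?thesis
    proof (cases "Y \<le> real (card U)")
      case True
      have "Y \<le> real (card (f S \<union> U))" if "S \<in> X" for S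
        using card_mono[of "f S \<union> U" U] f[OF that] fU True by simp
      then have "?ok xs = X" using xs by (auto simp: U_def min_le_iff_disj)
      then show ?thesis by simp
    next
      case False
      then have Uq: "real q * \<theta> / 2 \<le> real (card U)" using xs by (auto simp: U_def min_def split: if_splits)
      \<comment> \<open>The wasteful choices; the double count below shows that they form at most
        half of \<open>X\<close>.\<close>
      define Z where "Z = {S\<in>X. \<theta> / 2 < real (card (f S \<inter> U))}"
      have "S \<in> ?ok xs" if S: "S \<in> X" "S \<notin> Z" for S
      proof -
        have "card (f S \<union> U) + card (f S \<inter> U) = card (f S) + card U"
          using card_Un_Int[OF f[OF S(1)] fU] by simp
        then have "real (card (f S \<union> U)) + real (card (f S \<inter> U)) = real (card (f S)) + real (card U)"
          by (simp flip: of_nat_add)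
        moreover have "real (card (f S \<inter> U)) \<le> \<theta> / 2" using S by (auto simp: Z_def)
        ultimately have "real (Suc q) * \<theta> / 2 \<le> real (card (f S \<union> U))"
          using \<theta>(2)[OF S(1)] Uq by (simp add: algebra_simps)
        then show ?thesis using S xs by (auto simp: U_def min_le_iff_disj)
      qed
      then have "X - Z \<subseteq> ?ok xs" by blast
      then have le: "card (X - Z) \<le> card (?ok xs)" using X by (intro card_mono) auto
      have "real (card Z) * (\<theta> / 2) \<le> (\<Sum>S\<in>Z. real (card (f S \<inter> U)))"
        using sum_bounded_below[of Z "\<theta> / 2" "\<lambda>S. real (card (f S \<inter> U))"] by (auto simp: Z_def)
      also have "\<dots> \<le> (\<Sum>S\<in>X. real (card (f S \<inter> U)))"
        using X by (intro sum_mono2) (auto simp: Z_def)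
      also have "\<dots> = (\<Sum>S\<in>X. \<Sum>T\<in>U. if T \<in> f S then 1 else 0)"
        using fU by (intro sum.cong) (auto simp: Int_def conj_commute simp flip: sum.inter_filter)
      also have "\<dots> = (\<Sum>T\<in>U. \<Sum>S\<in>X. if T \<in> f S then 1 else 0)"
        by (rule sum.swap)
      also have "\<dots> = (\<Sum>T\<in>U. real (card {S\<in>X. T \<in> f S}))"
        using X by (intro sum.cong) (auto simp flip: sum.inter_filter)
      also have "\<dots> \<le> real (card U) * B"
        using sum_bounded_above[of U "\<lambda>T. real (card {S\<in>X. T \<in> f S})" B] B by simp
      also have "\<dots> \<le> Y * B" using False B0 by (intro mult_right_mono) auto
      also have "\<dots> \<le> real (card X) / 2 * (\<theta> / 2)" using Y by (simp add: field_simps)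
      finally have "real (card Z) \<le> real (card X) / 2" using \<theta>(1) by (simp add: mult_le_cancel_right)
      moreover have "card (X - Z) = card X - card Z" "card Z \<le> card X"
        using X by (auto simp: Z_def card_Diff_subset card_mono)
      ultimately show ?thesis using le by linarith
    qed
  qed
  have "(real (card X) / 2) ^ Suc q \<le> real (card (?G q)) * (real (card X) / 2)"
    using mult_right_mono[OF Suc.IH, of "real (card X) / 2"] by (simp add: mult.commute)
  also have "\<dots> \<le> (\<Sum>xs\<in>?G q. real (card (?ok xs)))"
    using sum_bounded_below[of "?G q" "real (card X) / 2" "\<lambda>xs. real (card (?ok xs))"] ok by auto
  also have "\<dots> = real (card (Sigma (?G q) ?ok))"
    using fG X by simp
  also have "card (Sigma (?G q) ?ok) \<le> card (?G (Suc q))"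
    by (rule card_inj_on_le[where f = "\<lambda>(xs, S). S # xs", OF _ _ fG]) (auto simp: inj_on_def)
  finally show ?case by simp
qed

section \<open>Numerical bounds for sums over density levels\<close>

lemma sum_geometric_le:
  fixes r :: real
  assumes "0 \<le> r" "r < 1"
  shows "(\<Sum>i\<le>M. r ^ i) \<le> 1 / (1 - r)"
  using sum_le_suminf[OF summable_geometric[of r], of "{..M}"] suminf_geometric[of r] assms by simp

text \<open>\<open>4 ^ i\<close> is the growth of the list length and \<open>1 + i\<close> that of
  the logarithmic cost per entry. Their product must stay below the growth \<open>5 ^ i\<close> of
  the one-sided exponent; Bernoulli's inequality for \<open>5 / 4\<close> does it.\<close>

lemma linear_mult_four_pow_le: "real (1 + i) * 4 ^ i \<le> 4 * 5 ^ i"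
proof -
  have "1 + real i * (1 / 4) \<le> (1 + 1 / 4) ^ i"
    by (rule Bernoulli_inequality) simp
  then have "real (1 + i) \<le> 4 * (5 / 4) ^ i" by simp
  then have "real (1 + i) * 4 ^ i \<le> 4 * (5 / 4) ^ i * 4 ^ i"
    by (intro mult_right_mono) auto
  also have "\<dots> = 4 * 5 ^ i" by (simp add: power_divide)
  finally show ?thesis .
qed

lemma one_plus_le_five_pow: "real (1 + i) \<le> 5 ^ i"
proof (induction i)
  case (Suc i)
  have "real (1 + Suc i) \<le> 5 * real (1 + i)" by simp
  also have "\<dots> \<le> 5 * 5 ^ i" using Suc by (intro mult_left_mono) auto
  finally show ?case by simp
qed simp

text \<open>The situation in which no link is dense, for every size of \<open>S\<close>. The
  constant \<open>\<kappa>\<close> stays free and is chosen small at the end.\<close>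

locale spread_family =
  fixes V :: "'a set" and H :: "'a set set" and k :: nat and n p \<kappa> :: real
  assumes V: "finite V" and H: "H \<subseteq> ksubs V k" and k: "2 \<le> k"
    and n_def: "n = real (card V)" and n_pos: "0 < n" and p_pos: "0 < p"
    and card_H: "real (card H) = p * n ^ k"
    and \<kappa>: "0 < \<kappa>"
    and spread: "\<And>a S. 1 \<le> a \<Longrightarrow> a < k \<Longrightarrow> S \<in> ksubs V a \<Longrightarrow> real (card (nbrs H S)) \<le> \<kappa> * sqrt p * n ^ (k - a)"
begin

definition lev :: "nat \<Rightarrow> real" where "lev i = \<kappa> * sqrt p / 2 ^ i"

definition layer :: "nat \<Rightarrow> nat \<Rightarrow> 'a set set" where
  "layer a i = {S \<in> ksubs V a. lev i / 2 * n ^ (k - a) < real (card (nbrs H S)) \<and>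
     real (card (nbrs H S)) \<le> lev i * n ^ (k - a)}"

text \<open>The restriction to \<open>T\<close> whose own link is no denser than level
  \<open>i\<close> is what limits how many sets \<open>S\<close> share a given \<open>T\<close>;
  without it the unions of links could overlap too much.\<close>

definition low_nbrs :: "nat \<Rightarrow> nat \<Rightarrow> 'a set \<Rightarrow> 'a set set" where
  "low_nbrs a i S = {T \<in> nbrs H S. real (card (nbrs H T)) \<le> lev i * n ^ a}"

text \<open>The ratio 15/16 makes the masses summable, while the density \<open>(mass i)\<^sup>2 * 2 ^ i\<close> of the
  families produced at level \<open>i\<close> has a cube growing like \<open>5 ^ i\<close>, faster than the length
  \<open>4 ^ i\<close> of the sequences. This is where \<open>l \<ge> 3\<close> is needed.\<close>

definition mass :: "nat \<Rightarrow> real" where "mass i = (15 / 16) ^ i / (32 * real k)"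

lemma lev_pos: "0 < lev i" using \<kappa> p_pos by (simp add: lev_def)

lemma mass_pos: "0 < mass i" using k by (simp add: mass_def)

lemma finite_H: "finite H" using H V finite_subset by fastforce

lemma finite_layer [simp]: "finite (layer a i)" using V by (simp add: layer_def)

lemma finite_low_nbrs [simp]: "finite (low_nbrs a i S)"
  using finite_nbrs[OF V H] by (simp add: low_nbrs_def)

lemma n_power_split: "a \<le> k \<Longrightarrow> n ^ k = n ^ a * n ^ (k - a)"
  by (simp flip: power_add)

text \<open>Each member has a link larger than \<open>lev i / 2 * n ^ (k - a)\<close>, and all links
  of \<open>a\<close>-sets together have size \<open>(k choose a) * card H\<close>.\<close>

lemma card_layer_le:
  assumes "a \<le> k"
  shows "real (card (layer a i)) \<le> 2 ^ (k + 1) * (p / lev i) * n ^ a"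
proof -
  have "real (card (layer a i)) * (lev i / 2 * n ^ (k - a)) \<le> (\<Sum>S\<in>layer a i. real (card (nbrs H S)))"
    using sum_bounded_below[of "layer a i" "lev i / 2 * n ^ (k - a)" "\<lambda>S. real (card (nbrs H S))"]
    by (auto simp: layer_def)
  also have "\<dots> \<le> (\<Sum>S\<in>ksubs V a. real (card (nbrs H S)))"
    using V by (intro sum_mono2) (auto simp: layer_def)
  also have "\<dots> = real (k choose a) * (p * n ^ k)"
    using sum_card_nbrs[OF V H, of a] by (simp flip: card_H of_nat_sum of_nat_mult)
  also have "\<dots> \<le> 2 ^ k * (p * n ^ k)"
  proof (intro mult_right_mono)
    show "real (k choose a) \<le> 2 ^ k"
      using binomial_le_pow2[of k a] by (metis of_nat_le_iff of_nat_numeral of_nat_power)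
  qed (use p_pos n_pos in simp)
  also have "\<dots> = (2 ^ (k + 1) * (p / lev i) * n ^ a) * (lev i / 2 * n ^ (k - a))"
    using lev_pos[of i] by (simp add: n_power_split[OF assms] field_simps)
  finally show ?thesis
    using lev_pos[of i] n_pos by (subst (asm) mult_le_cancel_right_pos) auto
qed

lemma ex_level:
  assumes "0 < x" "x \<le> \<kappa> * sqrt p"
  obtains i where "lev i / 2 < x" "x \<le> lev i"
proof -
  define i where "i = (LEAST i. lev i / 2 < x)"
  have lim: "(\<lambda>i. \<kappa> * sqrt p / 2 * (1 / 2) ^ i) \<longlonglongrightarrow> \<kappa> * sqrt p / 2 * 0"
    by (intro tendsto_mult tendsto_const LIMSEQ_power_zero) auto
  then have "eventually (\<lambda>i. \<kappa> * sqrt p / 2 * (1 / 2) ^ i < x) sequentially"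
    using assms(1) by (intro order_tendstoD(2)[OF lim]) auto
  then obtain j where "\<kappa> * sqrt p / 2 * (1 / 2) ^ j < x"
    by (auto simp: eventually_sequentially)
  then have "lev j / 2 < x"
    by (simp add: lev_def power_one_over mult.commute)
  then have i: "lev i / 2 < x" unfolding i_def by (rule LeastI)
  have "x \<le> lev i"
  proof (cases i)
    case 0
    then show ?thesis using assms by (simp add: lev_def)
  next
    case (Suc j)
    then have "\<not> lev j / 2 < x" using not_less_Least[of j "\<lambda>i. lev i / 2 < x"] by (simp add: i_def)
    then show ?thesis using Suc by (simp add: lev_def)
  qed
  with i show ?thesis by (rule that)
qed

text \<open>Every edge splits into two nonempty colour parts; take as \<open>S\<close> the part with
  the larger link density and as \<open>i\<close> its level, and the other part lies in
  \<open>low_nbrs a i S\<close>. If every colour, size and level fell short of its share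
  \<open>mass i\<close>, there would be too few edges.\<close>

lemma proper_coloring_heavy_layer:
  assumes A: "A \<subseteq> V" "\<And>e. e \<in> H \<Longrightarrow> \<not> e \<subseteq> A \<and> \<not> e \<subseteq> V - A"
  obtains C a i where "C \<in> {A, V - A}" "1 \<le> a" "a < k"
    "mass i * p * n ^ k \<le> (\<Sum>S\<in>{S\<in>layer a i. S \<subseteq> C}. real (card (low_nbrs a i S)))"
proof (rule ccontr)
  assume neg: "\<not> thesis"
  note heavy = that
  define Q where "Q C a i = Sigma {S\<in>layer a i. S \<subseteq> C} (low_nbrs a i)" for C a i
  have cardQ: "real (card (Q C a i)) = (\<Sum>S\<in>{S\<in>layer a i. S \<subseteq> C}. real (card (low_nbrs a i S)))" for C a i
    by (simp add: Q_def)
  have lt: "real (card (Q C a i)) < mass i * p * n ^ k" if "C \<in> {A, V - A}" "1 \<le> a" "a < k" for C a i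
    using neg heavy[OF that, of i] unfolding cardQ by linarith
  have ex: "\<exists>C a i. C \<in> {A, V - A} \<and> 1 \<le> a \<and> a < k \<and> e \<in> (\<lambda>(S, T). T \<union> S) ` Q C a i" if e: "e \<in> H" for e
  proof -
    have main: "\<exists>i. e \<in> (\<lambda>(S, T). T \<union> S) ` Q C (card S) i"
      if ST: "S \<union> T = e" "S \<inter> T = {}" "S \<noteq> {}" "T \<noteq> {}" "S \<subseteq> C" 
        and le: "real (card (nbrs H T)) / n ^ card S \<le> real (card (nbrs H S)) / n ^ (k - card S)" for S T C
    proof -
      have ek: "e \<subseteq> V" "card e = k" "finite e"
        using e H ksubs_finite_elem[OF V, of e k] by (auto simp: ksubs_def)
      have fin: "finite S" "finite T" using ST ek by (auto intro: finite_subset)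
      have card: "card S + card T = k" using card_Un_disjoint[OF fin ST(2)] ST(1) ek by simp
      have a: "1 \<le> card S" "card S < k" using card ST fin by (auto simp: Suc_le_eq card_gt_0_iff)
      have SV: "S \<in> ksubs V (card S)" using ST ek by (auto simp: ksubs_def)
      have TS: "T \<in> nbrs H S" using ST e by (auto simp: nbrs_def Un_commute)
      define x where "x = real (card (nbrs H S)) / n ^ (k - card S)"
      have "0 < card (nbrs H S)" using TS finite_nbrs[OF V H, of S] by (auto simp: card_gt_0_iff)
      then have x0: "0 < x" using n_pos by (simp add: x_def)
      have x1: "x \<le> \<kappa> * sqrt p" using spread[OF a SV] n_pos by (simp add: x_def field_simps)
      obtain i where i: "lev i / 2 < x" "x \<le> lev i" using ex_level[OF x0 x1] .
      have "S \<in> layer (card S) i" using i SV n_pos by (auto simp: layer_def x_def field_simps)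
      moreover have "T \<in> low_nbrs (card S) i S"
      proof -
        have "real (card (nbrs H T)) / n ^ card S \<le> lev i" using le i by (simp add: x_def)
        then show ?thesis using TS n_pos by (simp add: low_nbrs_def field_simps)
      qed
      ultimately have "(S, T) \<in> Q C (card S) i" using ST by (auto simp: Q_def)
      then show ?thesis using ST(1) by (intro exI[of _ i] image_eqI[of _ _ "(S, T)"]) (auto simp: Un_commute)
    qed
    have ek: "e \<subseteq> V" "card e = k" "finite e"
      using e H ksubs_finite_elem[OF V, of e k] by (auto simp: ksubs_def)
    define S T where "S = e \<inter> A" and "T = e - A"
    have ST: "S \<union> T = e" "S \<inter> T = {}" "S \<noteq> {}" "T \<noteq> {}" "S \<subseteq> A" "T \<subseteq> V - A"
      using A(2)[OF e] ek by (auto simp: S_def T_def)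
    have fin: "finite S" "finite T" using ek by (auto simp: S_def T_def)
    have card: "card S + card T = k" using card_Un_disjoint[OF fin ST(2)] ST(1) ek by simp
    have a: "1 \<le> card S" "card S < k" "1 \<le> card T" "card T < k"
      using card ST fin by (auto simp: Suc_le_eq card_gt_0_iff)
    have kk: "k - card S = card T" "k - card T = card S" using card by auto
    show ?thesis
    proof (cases "real (card (nbrs H T)) / n ^ card S \<le> real (card (nbrs H S)) / n ^ (k - card S)")
      case True
      then show ?thesis using main[OF ST(1-5) True] a by blast
    next
      case False
      then have le: "real (card (nbrs H S)) / n ^ card T \<le> real (card (nbrs H T)) / n ^ (k - card T)"
        by (simp add: kk)
      have TS: "T \<union> S = e" "T \<inter> S = {}" using ST by auto
      obtain i where "e \<in> (\<lambda>(S, T). T \<union> S) ` Q (V - A) (card T) i"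
        using main[OF TS ST(4,3,6) le] by (rule exE)
      moreover have "V - A \<in> {A, V - A}" by simp
      ultimately show ?thesis using a(3,4) by blast
    qed
  qed
  obtain i0 where i0: "\<And>e. e \<in> H \<Longrightarrow> \<exists>C a. C \<in> {A, V - A} \<and> 1 \<le> a \<and> a < k \<and> e \<in> (\<lambda>(S, T). T \<union> S) ` Q C a (i0 e)"
    using ex by metis
  \<comment> \<open>Only finitely many levels occur, so the shares can be added as finite
    sums.\<close>
  define M where "M = Max (insert 0 (i0 ` H))"
  have iM: "i0 e \<le> M" if "e \<in> H" for e
    using that finite_H by (auto simp: M_def)
  define J where "J = {A, V - A} \<times> {1..<k} \<times> {..M}"
  have "H \<subseteq> (\<Union>(C, a, i)\<in>J. (\<lambda>(S, T). T \<union> S) ` Q C a i)"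
  proof
    fix e assume e: "e \<in> H"
    obtain C a where "C \<in> {A, V - A}" "1 \<le> a" "a < k" "e \<in> (\<lambda>(S, T). T \<union> S) ` Q C a (i0 e)"
      using i0[OF e] by blast
    then show "e \<in> (\<Union>(C, a, i)\<in>J. (\<lambda>(S, T). T \<union> S) ` Q C a i)"
      using iM[OF e] by (intro UN_I[of "(C, a, i0 e)"]) (auto simp: J_def)
  qed
  moreover have "finite (Q C a i)" for C a i
    unfolding Q_def by (intro finite_SigmaI) auto
  moreover have "finite J" by (simp add: J_def)
  ultimately have "card H \<le> card (\<Union>(C, a, i)\<in>J. (\<lambda>(S, T). T \<union> S) ` Q C a i)"
    by (intro card_mono) auto
  also have "\<dots> \<le> (\<Sum>(C, a, i)\<in>J. card ((\<lambda>(S, T). T \<union> S) ` Q C a i))"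
    using card_UN_le[OF \<open>finite J\<close>, of "\<lambda>(C, a, i). (\<lambda>(S, T). T \<union> S) ` Q C a i"]
    by (simp add: case_prod_beta)
  also have "\<dots> \<le> (\<Sum>(C, a, i)\<in>J. card (Q C a i))"
    using \<open>\<And>C a i. finite (Q C a i)\<close> by (intro sum_mono) (auto intro: card_image_le)
  finally have "real (card H) \<le> real (\<Sum>(C, a, i)\<in>J. card (Q C a i))"
    unfolding of_nat_le_iff .
  also have "\<dots> = (\<Sum>(C, a, i)\<in>J. real (card (Q C a i)))"
    by (simp add: case_prod_beta)
  also have "\<dots> \<le> (\<Sum>(C, a, i)\<in>J. mass i * p * n ^ k)"
    using lt by (intro sum_mono) (auto simp: J_def intro: less_imp_le)
  also have "\<dots> = real (card {A, V - A}) * (real (k - 1) * (\<Sum>i\<le>M. mass i * p * n ^ k))"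
    by (simp add: J_def flip: sum.cartesian_product)
  \<comment> \<open>Origin of \<open>32 * real k\<close> in \<open>mass\<close>: two colours,
    \<open>k - 1\<close> sizes and a geometric sum of at most 16 leave the fraction
    \<open>(k - 1) / k < 1\<close> of the edges.\<close>
  also have "\<dots> \<le> 2 * (real (k - 1) * (1 / (2 * real k) * (p * n ^ k)))"
  proof (intro mult_mono)
    show "real (card {A, V - A}) \<le> 2"
      using card_insert_le_m1[of 2 "{V - A}" A] by simp
    have "(\<Sum>i\<le>M. mass i * p * n ^ k) = (\<Sum>i\<le>M. (15 / 16) ^ i) / (32 * real k) * (p * n ^ k)"
      by (simp only: mass_def sum_distrib_right sum_divide_distrib mult.assoc)
    also have "\<dots> \<le> 16 / (32 * real k) * (p * n ^ k)"
      using sum_geometric_le[of "15 / 16" M] p_pos n_pos by (intro mult_right_mono divide_right_mono) auto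
    finally show "(\<Sum>i\<le>M. mass i * p * n ^ k) \<le> 1 / (2 * real k) * (p * n ^ k)" by simp
  qed (use mass_pos p_pos n_pos in \<open>auto intro!: sum_nonneg mult_nonneg_nonneg intro: less_imp_le\<close>)
  also have "\<dots> = real (k - 1) / real k * (p * n ^ k)" by simp
  also have "\<dots> < 1 * (p * n ^ k)"
    using k p_pos n_pos by (intro mult_strict_right_mono) auto
  finally show False by (simp add: card_H)
qed

end

section \<open>Lists of sets of one colour and the unions of their links\<close>

context spread_family
begin

text \<open>Chosen so that \<open>thr a i\<close> times the bound of \<open>card_layer_le\<close> is
  half of \<open>mass i * p * n ^ k\<close>: discarding the sets below it loses at most half of the
  share.\<close>

definition thr :: "nat \<Rightarrow> nat \<Rightarrow> real" where
  "thr a i = mass i * lev i / 2 ^ (k + 2) * n ^ (k - a)"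

definition rich :: "nat \<Rightarrow> nat \<Rightarrow> 'a set set" where
  "rich a i = {S \<in> layer a i. thr a i \<le> real (card (low_nbrs a i S))}"

text \<open>The largest target \<open>Y\<close> that \<open>card_lists_large_union\<close> allows
  with \<open>\<theta> = thr a i\<close>, multiplicity \<open>lev i * n ^ a\<close> and
  \<open>min_rich a i\<close> available sets; see \<open>goal_card_eq\<close>.\<close>

definition goal_card :: "nat \<Rightarrow> nat \<Rightarrow> real" where
  "goal_card a i = mass i ^ 2 * p / (2 ^ (k + 5) * lev i) * n ^ (k - a)"

text \<open>The remaining half of the share, divided by the largest link size
  \<open>lev i * n ^ (k - a)\<close> in the layer.\<close>

definition min_rich :: "nat \<Rightarrow> nat \<Rightarrow> real" where
  "min_rich a i = mass i * p / (2 * lev i) * n ^ a"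

text \<open>Long enough that steps of size \<open>thr a i / 2\<close> reach
  \<open>goal_card a i\<close>.\<close>

definition len :: "nat \<Rightarrow> nat \<Rightarrow> nat" where
  "len a i = nat \<lceil>2 * goal_card a i / thr a i\<rceil>"

definition cover :: "nat \<Rightarrow> nat \<Rightarrow> 'a set list \<Rightarrow> 'a set set" where
  "cover a i xs = (\<Union>S\<in>set xs. low_nbrs a i S)"

text \<open>Depends on \<open>H\<close> alone and not on a colouring, so the expected number of
  evadable lists can be computed before any colouring is chosen.\<close>

definition good_lists :: "nat \<Rightarrow> nat \<Rightarrow> 'a set list set" where
  "good_lists a i = {xs. set xs \<subseteq> rich a i \<and> length xs = len a i \<and> goal_card a i \<le> real (card (cover a i xs))}"

lemma thr_pos: "0 < thr a i" 
  using mass_pos lev_pos n_pos by (simp add: thr_def)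

lemma min_rich_pos: "0 < min_rich a i"
  using mass_pos lev_pos n_pos p_pos by (simp add: min_rich_def)

lemma goal_card_pos: "0 < goal_card a i"
  using mass_pos[of i] lev_pos n_pos p_pos by (simp add: goal_card_def)

lemma finite_rich [simp]: "finite (rich a i)" by (simp add: rich_def)

lemma finite_good_lists: "finite (good_lists a i)"
  unfolding good_lists_def
  by (rule finite_subset[OF _ finite_lists_length_eq[of "rich a i" "len a i"]]) auto

lemma card_good_lists_le: "card (good_lists a i) \<le> card (rich a i) ^ len a i"
  unfolding good_lists_def card_lists_length_eq[OF finite_rich, symmetric]
  by (intro card_mono finite_lists_length_eq) auto

lemma cover_subset:
  assumes "xs \<in> good_lists a i"
  shows "cover a i xs \<subseteq> ksubs V (k - a)"
proof -
  have "low_nbrs a i S \<subseteq> ksubs V (k - a)" if "S \<in> set xs" for S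
    using nbrs_subset_ksubs[OF V H, of S a] that assms
    by (auto simp: good_lists_def rich_def layer_def low_nbrs_def)
  then show ?thesis by (auto simp: cover_def)
qed

lemma card_rich_subset_ge:
  assumes a: "a < k" and X: "mass i * p * n ^ k \<le> (\<Sum>S\<in>{S\<in>layer a i. S \<subseteq> C}. real (card (low_nbrs a i S)))"
  shows "min_rich a i \<le> real (card {S\<in>rich a i. S \<subseteq> C})"
proof -
  let ?X = "{S\<in>rich a i. S \<subseteq> C}"
  have le: "real (card (low_nbrs a i S)) \<le> lev i * n ^ (k - a)" if "S \<in> layer a i" for S
  proof -
    have "card (low_nbrs a i S) \<le> card (nbrs H S)"
      by (rule card_mono[OF finite_nbrs[OF V H]]) (auto simp: low_nbrs_def)
    then show ?thesis using that by (auto simp: layer_def)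
  qed
  have l0: "0 \<le> lev i * n ^ (k - a)" using lev_pos[of i] n_pos by simp
  have "mass i * p * n ^ k \<le> (\<Sum>S\<in>{S\<in>layer a i. S \<subseteq> C}. real (card (low_nbrs a i S)))" by (rule X)
  also have "\<dots> \<le> (\<Sum>S\<in>{S\<in>layer a i. S \<subseteq> C}. (if S \<in> ?X then lev i * n ^ (k - a) else 0) + thr a i)"
    using le thr_pos[of a i] l0 by (intro sum_mono) (auto simp: rich_def intro: add_increasing2)
  also have "\<dots> = real (card ({S\<in>layer a i. S \<subseteq> C} \<inter> ?X)) * (lev i * n ^ (k - a)) + real (card {S\<in>layer a i. S \<subseteq> C}) * thr a i"
    by (subst sum.distrib, subst sum.inter_restrict[symmetric]) simp_all
  also have "{S\<in>layer a i. S \<subseteq> C} \<inter> ?X = ?X" by (auto simp: rich_def)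
  also have "real (card {S\<in>layer a i. S \<subseteq> C}) * thr a i \<le> real (card (layer a i)) * thr a i"
    using thr_pos[of a i] by (intro mult_right_mono) (auto intro: card_mono)
  also have "\<dots> \<le> (2 ^ (k + 1) * (p / lev i) * n ^ a) * thr a i"
    using card_layer_le[of a i] a thr_pos[of a i] by (intro mult_right_mono) auto
  also have "\<dots> = mass i * p * n ^ k / 2"
    using lev_pos[of i] a by (simp add: thr_def n_power_split[of a] field_simps)
  finally have "mass i * p * n ^ k / 2 \<le> real (card ?X) * (lev i * n ^ (k - a))" by simp
  also have "mass i * p * n ^ k / 2 = min_rich a i * (lev i * n ^ (k - a))"
    using lev_pos[of i] a by (simp add: min_rich_def n_power_split[of a] field_simps)
  finally show ?thesis
    using lev_pos[of i] n_pos by (subst (asm) mult_le_cancel_right_pos) auto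
qed

lemma goal_card_eq: "a \<le> k \<Longrightarrow> goal_card a i * (lev i * n ^ a) = thr a i * min_rich a i / 4"
  using lev_pos[of i]
  by (simp add: goal_card_def thr_def min_rich_def power2_eq_square field_simps) (simp add: power_add)

text \<open>For sets \<open>S\<close> inside the class \<open>C\<close>, no member of their links
  lies in \<open>C\<close>, since together with \<open>S\<close> it would form an edge inside
  \<open>C\<close>. So \<open>C\<close> witnesses evasion for every list of subsets of
  \<open>C\<close>, and \<open>card_lists_large_union\<close> counts the good ones.\<close>

lemma many_evadable_lists:
  assumes a: "a < k" and C: "C \<subseteq> V" "\<And>e. e \<in> H \<Longrightarrow> \<not> e \<subseteq> C" "\<And>r. r \<in> R \<Longrightarrow> \<not> r \<subseteq> V - C"
    and X: "mass i * p * n ^ k \<le> (\<Sum>S\<in>{S\<in>layer a i. S \<subseteq> C}. real (card (low_nbrs a i S)))"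
  shows "(min_rich a i / 2) ^ len a i \<le> real (card {xs \<in> good_lists a i. evadable V (cover a i xs) R})"
proof -
  let ?X = "{S\<in>rich a i. S \<subseteq> C}"
  let ?B = "lev i * n ^ a"
  let ?G = "{xs. set xs \<subseteq> ?X \<and> length xs = len a i \<and>
       min (goal_card a i) (real (len a i) * thr a i / 2) \<le> real (card (\<Union>S\<in>set xs. low_nbrs a i S))}"
  have B0: "0 \<le> ?B" using lev_pos[of i] n_pos by simp
  have x: "min_rich a i \<le> real (card ?X)" by (rule card_rich_subset_ge[OF a X])
  have len: "goal_card a i \<le> real (len a i) * thr a i / 2"
  proof -
    have "2 * goal_card a i / thr a i \<le> real (len a i)"
      unfolding len_def by (rule real_nat_ceiling_ge)
    then show ?thesis using thr_pos[of a i] by (simp add: field_simps)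
  qed
  have "(min_rich a i / 2) ^ len a i \<le> (real (card ?X) / 2) ^ len a i"
    using x min_rich_pos[of a i] by (intro power_mono) auto
  also have "\<dots> \<le> real (card ?G)"
  \<comment> \<open>Every \<open>S\<close> having \<open>T\<close> in \<open>low_nbrs a i S\<close>
    lies in the link of \<open>T\<close>, whose size is capped by the definition of
    \<open>low_nbrs\<close>.\<close>
  proof (rule card_lists_large_union[where B = ?B])
    fix T
    show "real (card {S \<in> ?X. T \<in> low_nbrs a i S}) \<le> ?B"
    proof (cases "{S \<in> ?X. T \<in> low_nbrs a i S} = {}")
      case True
      show ?thesis unfolding True using B0 by simp
    next
      case False
      then have "real (card (nbrs H T)) \<le> ?B" by (auto simp: low_nbrs_def)
      moreover have "card {S \<in> ?X. T \<in> low_nbrs a i S} \<le> card (nbrs H T)"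
        by (rule card_mono[OF finite_nbrs[OF V H]]) (auto simp: low_nbrs_def nbrs_commute)
      ultimately show ?thesis by linarith
    qed
  next
    have "goal_card a i * ?B = thr a i * min_rich a i / 4" using a by (simp add: goal_card_eq)
    also have "\<dots> \<le> thr a i * real (card ?X) / 4"
      using x thr_pos[of a i] by (simp add: mult_left_mono)
    finally show "goal_card a i * ?B \<le> thr a i * real (card ?X) / 4" .
  qed (use thr_pos in \<open>auto simp: rich_def\<close>)
  also have "card ?G \<le> card {xs \<in> good_lists a i. evadable V (cover a i xs) R}"
  proof (rule card_mono)
    show "?G \<subseteq> {xs \<in> good_lists a i. evadable V (cover a i xs) R}"
    proof safe
      fix xs assume xs: "set xs \<subseteq> ?X" "length xs = len a i"
        "min (goal_card a i) (real (len a i) * thr a i / 2) \<le> real (card (\<Union>S\<in>set xs. low_nbrs a i S))"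
      show "xs \<in> good_lists a i" using xs len by (auto simp: good_lists_def cover_def)
      have "\<not> f \<subseteq> C" if f: "f \<in> cover a i xs" for f
      proof -
        obtain S where "S \<in> set xs" "f \<in> low_nbrs a i S" using f by (auto simp: cover_def)
        then have "f \<union> S \<in> H" "S \<subseteq> C" using xs by (auto simp: low_nbrs_def nbrs_def)
        then show ?thesis using C(2) by blast
      qed
      then show "evadable V (cover a i xs) R"
        unfolding evadable_def using C(1,3) by (intro exI[of _ C] conjI ballI) auto
    qed
  qed (use finite_good_lists in simp)
  finally show ?thesis by simp
qed

text \<open>A level that carries a pair has a nonempty link, so
  \<open>1 \<le> lev i * n ^ k\<close>, which bounds \<open>2 ^ i\<close> and hence
  \<open>i\<close>. The bound may be crude, as the failure probabilities form a geometric series in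
  \<open>i\<close>.\<close>

definition heavy_bound :: nat where "heavy_bound = nat \<lceil>\<kappa> * sqrt p * n ^ k\<rceil>"

text \<open>Eliminates the colouring: colourability implies one of finitely many events about
  \<open>R\<close>, indexed by size and level.\<close>

lemma colorable_imp_many_lists:
  assumes "colorable V (H \<union> R)"
  shows "\<exists>a\<in>{1..<k}. \<exists>i\<in>{..heavy_bound}.
    (min_rich a i / 2) ^ len a i \<le> real (card {xs \<in> good_lists a i. evadable V (cover a i xs) R})"
proof -
  obtain A where A: "A \<subseteq> V" "\<And>e. e \<in> H \<union> R \<Longrightarrow> \<not> e \<subseteq> A \<and> \<not> e \<subseteq> V - A"
    using assms by (auto simp: colorable_def)
  then have A': "\<not> e \<subseteq> A \<and> \<not> e \<subseteq> V - A" if "e \<in> H" for e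
    using that by blast
  obtain C a i where C: "C \<in> {A, V - A}" and a: "1 \<le> a" "a < k" and
    X: "mass i * p * n ^ k \<le> (\<Sum>S\<in>{S\<in>layer a i. S \<subseteq> C}. real (card (low_nbrs a i S)))"
    by (rule proper_coloring_heavy_layer[OF A(1)]) (rule A', assumption, rule that)
  have VA: "V - (V - A) = A" using A by auto
  have C': "C \<subseteq> V" "\<And>e. e \<in> H \<Longrightarrow> \<not> e \<subseteq> C" "\<And>r. r \<in> R \<Longrightarrow> \<not> r \<subseteq> V - C"
    using C A VA by auto
  have "0 < mass i * p * n ^ k" using mass_pos p_pos n_pos by simp
  then have "0 < (\<Sum>S\<in>{S\<in>layer a i. S \<subseteq> C}. real (card (low_nbrs a i S)))" using X by linarith
  then obtain S where S: "S \<in> layer a i" "card (low_nbrs a i S) \<noteq> 0"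
    by (metis (no_types, lifting) less_irrefl mem_Collect_eq of_nat_0 sum.neutral)
  have "1 \<le> card (low_nbrs a i S)" using S(2) by linarith
  also have "\<dots> \<le> card (nbrs H S)"
    by (rule card_mono[OF finite_nbrs[OF V H]]) (auto simp: low_nbrs_def)
  finally have "1 \<le> real (card (nbrs H S))" by simp
  also have "\<dots> \<le> lev i * n ^ (k - a)" using S by (simp add: layer_def)
  also have "\<dots> \<le> lev i * n ^ k"
  proof -
    have "1 \<le> n" using n_pos by (simp add: n_def Suc_le_eq)
    then show ?thesis using lev_pos[of i] by (intro mult_left_mono power_increasing) auto
  qed
  finally have "2 ^ i \<le> \<kappa> * sqrt p * n ^ k" by (simp add: lev_def field_simps)
  moreover have "real i \<le> 2 ^ i" using less_exp[of i] by (metis less_imp_le of_nat_le_iff of_nat_numeral of_nat_power)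
  ultimately have "i \<le> heavy_bound" unfolding heavy_bound_def by linarith
  moreover have "(min_rich a i / 2) ^ len a i \<le> real (card {xs \<in> good_lists a i. evadable V (cover a i xs) R})"
    by (rule many_evadable_lists[OF a(2) C'(1) _ _ X]) (rule C', assumption)+
  ultimately show ?thesis
    using a by (intro bexI[of _ a] bexI[of _ i]) auto
qed

text \<open>\<open>y\<close> is the density of a cover. By Markov, the survival probability of one
  list is multiplied by the ratio of all good lists to those demanded. Per entry this ratio is at
  most \<open>2 ^ (k + 3) / mass i\<close>: the powers of \<open>p\<close>, \<open>lev i\<close> and
  \<open>n\<close> in \<open>card_layer_le\<close> and \<open>min_rich\<close> cancel.\<close>

lemma rprob_many_lists_le:
  assumes a: "a < k" and Cc: "0 \<le> C"
    and ev: "\<And>F y. F \<subseteq> ksubs V (k - a) \<Longrightarrow> 0 < y \<Longrightarrow> y * n ^ (k - a) \<le> real (card F) \<Longrightarrow>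
         K \<le> y * n \<Longrightarrow> rprob V l m (evadable V F) \<le> C * exp (- c * real m * y ^ l)"
    and y: "y = mass i ^ 2 * p / (2 ^ (k + 5) * lev i)" "K \<le> y * n"
  shows "rprob V l m (\<lambda>R. (min_rich a i / 2) ^ len a i \<le> real (card {xs \<in> good_lists a i. evadable V (cover a i xs) R}))
     \<le> (2 ^ (k + 3) / mass i) ^ len a i * (C * exp (- c * real m * y ^ l))"
proof -
  have y0: "0 < y" using y(1) mass_pos[of i] lev_pos[of i] p_pos by simp
  have "rprob V l m (evadable V (cover a i xs)) \<le> C * exp (- c * real m * y ^ l)" if "xs \<in> good_lists a i" for xs
    using cover_subset[OF that] that y0 y(2)
    by (intro ev) (auto simp: good_lists_def goal_card_def y(1))
  then have "rprob V l m (\<lambda>R. (min_rich a i / 2) ^ len a i \<le> real (card {xs \<in> good_lists a i. evadable V (cover a i xs) R}))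
     \<le> real (card (good_lists a i)) * (C * exp (- c * real m * y ^ l)) / (min_rich a i / 2) ^ len a i"
    using min_rich_pos[of a i] by (intro rprob_card_Markov finite_good_lists) auto
  also have "\<dots> \<le> real (card (rich a i) ^ len a i) * (C * exp (- c * real m * y ^ l)) / (min_rich a i / 2) ^ len a i"
    using card_good_lists_le[of a i] min_rich_pos[of a i] Cc
    by (intro divide_right_mono mult_right_mono) (auto simp del: of_nat_power)
  also have "\<dots> = (real (card (rich a i)) / (min_rich a i / 2)) ^ len a i * (C * exp (- c * real m * y ^ l))"
    by (simp add: power_divide)
  also have "\<dots> \<le> (2 ^ (k + 3) / mass i) ^ len a i * (C * exp (- c * real m * y ^ l))"
  proof (intro mult_right_mono power_mono)
    have "real (card (rich a i)) \<le> real (card (layer a i))"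
      by (auto simp: rich_def intro!: card_mono)
    also have "\<dots> \<le> 2 ^ (k + 1) * (p / lev i) * n ^ a" using card_layer_le a by simp
    also have "\<dots> = 2 ^ (k + 3) / mass i * (min_rich a i / 2)"
      using mass_pos[of i] by (simp add: min_rich_def power_add field_simps)
    finally show "real (card (rich a i)) / (min_rich a i / 2) \<le> 2 ^ (k + 3) / mass i"
      by (rule mult_imp_div_pos_le[rotated]) (use min_rich_pos[of a i] in simp)
  qed (use Cc min_rich_pos[of a i] in auto)
  finally show ?thesis .
qed

end

text \<open>\<open>225 / 128\<close> is \<open>(15 / 16)^2 * 2\<close>, from two factors of
  \<open>mass\<close> and one division by \<open>lev\<close>. The covers exceed density
  \<open>sqrt p\<close> by a constant over \<open>\<kappa>\<close>.\<close>

lemma (in spread_family) layer_density_eq: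
  "mass i ^ 2 * p / (2 ^ (k + 5) * lev i) =
     1 / ((32 * real k)\<^sup>2 * 2 ^ (k + 5)) / \<kappa> * (225 / 128) ^ i * sqrt p"
proof -
  have "mass i ^ 2 * 2 ^ i = ((15 / 16) ^ 2 * 2) ^ i / (32 * real k)\<^sup>2"
  proof -
    have "((15 / 16 :: real) ^ i) ^ 2 * 2 ^ i = ((15 / 16) ^ 2 * 2) ^ i"
      by (metis mult.commute power_mult power_mult_distrib)
    then show ?thesis
      by (simp only: mass_def power_divide[of "(15 / 16) ^ i" "32 * real k" 2] times_divide_eq_left)
  qed
  also have "(15 / 16) ^ 2 * 2 = (225 / 128 :: real)" by (simp add: power2_eq_square)
  finally have m: "mass i ^ 2 * 2 ^ i = (225 / 128) ^ i / (32 * real k)\<^sup>2" .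
  have "mass i ^ 2 * p / (2 ^ (k + 5) * lev i) = (mass i ^ 2 * 2 ^ i) * (p / sqrt p) / (2 ^ (k + 5) * \<kappa>)"
    by (simp add: lev_def mult_ac)
  also have "p / sqrt p = sqrt p" using p_pos by (simp add: real_div_sqrt)
  finally show ?thesis unfolding m by simp
qed

text \<open>The quotient in \<open>len\<close> equals
  \<open>mass i * 4 ^ i / (4 * \<kappa>^2)\<close>; \<open>\<kappa> \<le> 1 / 2\<close> lets the
  remaining three quarters absorb the rounding.\<close>

lemma (in spread_family) len_le:
  assumes "\<kappa> \<le> 1 / 2" "a < k"
  shows "real (len a i) \<le> 4 ^ i / \<kappa>\<^sup>2"
proof -
  have "2 * goal_card a i / thr a i = mass i * p / (4 * (lev i)\<^sup>2)"
    using lev_pos[of i] mass_pos[of i] n_pos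
    by (simp add: goal_card_def thr_def power2_eq_square power_add field_simps)
  also have "\<dots> = mass i * (4 ^ i / \<kappa>\<^sup>2) / 4"
  proof -
    have "(lev i)\<^sup>2 = \<kappa>\<^sup>2 * p / 4 ^ i"
    proof -
      have "((2 :: real) ^ i)\<^sup>2 = (2 ^ 2) ^ i" by (metis mult.commute power_mult)
      then show ?thesis using p_pos by (simp add: lev_def power_divide power_mult_distrib)
    qed
    then show ?thesis using p_pos \<kappa> by simp
  qed
  also have "\<dots> \<le> 1 * (4 ^ i / \<kappa>\<^sup>2) / 4"
  proof (intro divide_right_mono mult_right_mono)
    have "(15 / 16 :: real) ^ i \<le> 1" by (intro power_le_one) auto
    then show "mass i \<le> 1" using k by (simp add: mass_def divide_le_eq)
  qed auto
  finally have "2 * goal_card a i / thr a i \<le> 4 ^ i / \<kappa>\<^sup>2 / 4" by simp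
  moreover have "0 \<le> 2 * goal_card a i / thr a i" using goal_card_pos[of a i] thr_pos[of a i] by simp
  ultimately have "real (len a i) \<le> 4 ^ i / \<kappa>\<^sup>2 / 4 + 1" unfolding len_def by linarith
  moreover have "4 \<le> 4 ^ i / \<kappa>\<^sup>2"
  proof -
    have "\<kappa>\<^sup>2 \<le> (1 / 2)\<^sup>2" using assms \<kappa> by (intro power_mono) auto
    then have "4 * \<kappa>\<^sup>2 \<le> 1" by (simp add: power2_eq_square)
    also have "1 \<le> (4 :: real) ^ i" by simp
    finally show ?thesis using \<kappa> by (simp add: field_simps)
  qed
  moreover have "x \<le> q" if "x \<le> q / 4 + 1" "4 \<le> q" for x q :: real
    using that by linarith
  ultimately show ?thesis by blast
qed

text \<open>At level \<open>i\<close> the lists cost the exponent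
  \<open>4 * ln D / \<kappa>\<^sup>2 * 5 ^ i\<close>, and the one-sided estimate gains
  \<open>c * (g / \<kappa>) ^ 3 * 5 ^ i\<close>. The extra power of \<open>1 / \<kappa>\<close>, due
  to \<open>3 \<le> l\<close>, leaves \<open>L * (1 + i)\<close> to spare for small
  \<open>\<kappa>\<close>, which is summable over all levels.\<close>

lemma (in spread_family) rprob_colorable_le:
  fixes C c L :: real and l m :: nat
  defines "g \<equiv> 1 / ((32 * real k)\<^sup>2 * 2 ^ (k + 5))"
  defines "D \<equiv> 2 ^ (k + 3) * (32 * real k)"
  assumes C: "0 \<le> C" and c: "0 < c" and L: "1 \<le> L"
    and ev: "\<And>a F y. a < k \<Longrightarrow> F \<subseteq> ksubs V (k - a) \<Longrightarrow> 0 < y \<Longrightarrow> y * n ^ (k - a) \<le> real (card F) \<Longrightarrow>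
         K \<le> y * n \<Longrightarrow> rprob V l m (evadable V F) \<le> C * exp (- c * real m * y ^ l)"
    and p1: "p \<le> 1" and K: "K \<le> p * n" and l: "3 \<le> l" and m: "1 \<le> real m * sqrt p ^ l"
    and \<kappa>': "\<kappa> \<le> 1 / 2" "\<kappa> \<le> g" "\<kappa> * (4 * ln D + L) \<le> c * g ^ 3"
  shows "rprob V l m (\<lambda>R. colorable V (H \<union> R)) \<le> real k * (2 * C * exp (- L))"
proof -
  have g: "0 < g" using k by (simp add: g_def)
  have D: "16 / 15 \<le> D"
  proof -
    have "1 * 32 \<le> D" unfolding D_def using k by (intro mult_mono) auto
    then show ?thesis by simp
  qed
  then have lnD: "0 \<le> ln D" "D = exp (ln D)" by auto
  let ?E = "\<lambda>a i R. (min_rich a i / 2) ^ len a i \<le> real (card {xs \<in> good_lists a i. evadable V (cover a i xs) R})"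
  have bound: "rprob V l m (?E a i) \<le> C * exp (- (L * real (1 + i)))" if a: "a < k" for a i
  proof -
    define y where "y = mass i ^ 2 * p / (2 ^ (k + 5) * lev i)"
    have y_eq: "y = g / \<kappa> * (225 / 128) ^ i * sqrt p"
      unfolding y_def layer_density_eq g_def by simp
    have g\<kappa>: "1 \<le> g / \<kappa>" using \<kappa>' \<kappa> by simp
    \<comment> \<open>The covers are at least as dense as \<open>H\<close>, so the bound on
      \<open>p * n\<close> also serves for them.\<close>
    have "1 * 1 * p \<le> g / \<kappa> * (225 / 128) ^ i * sqrt p"
    proof (intro mult_mono)
      have "p * p \<le> p" using p1 p_pos by (simp add: mult_left_le)
      then show "p \<le> sqrt p" using p_pos by (intro real_le_rsqrt) (simp add: power2_eq_square)
    qed (use g g\<kappa> \<kappa> p_pos in \<open>auto intro: one_le_power\<close>)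
    then have "p \<le> y" by (simp add: y_eq)
    then have "p * n \<le> y * n" using n_pos by (intro mult_right_mono) auto
    then have Ky: "K \<le> y * n" using K by linarith
    have e: "(g / \<kappa>) ^ 3 * 5 ^ i \<le> real m * y ^ l"
    proof -
      have "(g / \<kappa>) ^ 3 * 5 ^ i * 1 \<le> (g / \<kappa>) ^ l * ((225 / 128) ^ l) ^ i * (real m * sqrt p ^ l)"
      proof (intro mult_mono)
        show "(g / \<kappa>) ^ 3 \<le> (g / \<kappa>) ^ l" using g\<kappa> l by (intro power_increasing)
        have "(5 :: real) \<le> (225 / 128) ^ 3" by (simp add: power3_eq_cube)
        also have "\<dots> \<le> (225 / 128) ^ l" using l by (intro power_increasing) auto
        finally show "(5 :: real) ^ i \<le> ((225 / 128) ^ l) ^ i" by (intro power_mono) auto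
      qed (use m g \<kappa> in auto)
      also have "\<dots> = real m * y ^ l"
      proof -
        have "((225 / 128 :: real) ^ l) ^ i = ((225 / 128) ^ i) ^ l" by (metis mult.commute power_mult)
        then show ?thesis by (simp only: y_eq power_mult_distrib mult_ac)
      qed
      finally show ?thesis by simp
    qed
    \<comment> \<open>\<open>D\<close> bounds the constant factor of the cost per entry and also
      exceeds \<open>16 / 15\<close>, so that cost is at most \<open>D ^ (1 + i)\<close>.\<close>
    have len: "(2 ^ (k + 3) / mass i) ^ len a i \<le> exp (4 * ln D / \<kappa>\<^sup>2 * 5 ^ i)"
    proof -
      have "2 ^ (k + 3) / mass i = D * (16 / 15) ^ i"
        by (simp add: mass_def D_def power_divide)
      also have "\<dots> \<le> D * D ^ i" using D by (intro mult_left_mono power_mono) auto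
      also have "\<dots> = exp (ln D) ^ (1 + i)" using lnD by simp
      also have "\<dots> = exp (real (1 + i) * ln D)" by (simp only: exp_of_nat_mult)
      finally have "(2 ^ (k + 3) / mass i) ^ len a i \<le> exp (real (1 + i) * ln D) ^ len a i"
        using mass_pos[of i] by (intro power_mono) auto
      also have "\<dots> = exp (real (len a i) * (real (1 + i) * ln D))" by (simp only: exp_of_nat_mult)
      also have "real (len a i) * (real (1 + i) * ln D) \<le> 4 ^ i / \<kappa>\<^sup>2 * (real (1 + i) * ln D)"
        using len_le[OF \<kappa>'(1) a, of i] lnD by (intro mult_right_mono) auto
      also have "\<dots> = (real (1 + i) * 4 ^ i) * (ln D / \<kappa>\<^sup>2)" by simp
      also have "\<dots> \<le> (4 * 5 ^ i) * (ln D / \<kappa>\<^sup>2)"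
        using lnD by (intro mult_right_mono linear_mult_four_pow_le) auto
      finally show ?thesis by (simp add: mult_ac)
    qed
    have "rprob V l m (?E a i) \<le> (2 ^ (k + 3) / mass i) ^ len a i * (C * exp (- c * real m * y ^ l))"
      by (rule rprob_many_lists_le[OF a C ev[OF a] y_def Ky])
    also have "\<dots> \<le> exp (4 * ln D / \<kappa>\<^sup>2 * 5 ^ i) * (C * exp (- (c * ((g / \<kappa>) ^ 3 * 5 ^ i))))"
    proof (intro mult_mono len mult_left_mono)
      have "c * ((g / \<kappa>) ^ 3 * 5 ^ i) \<le> c * (real m * y ^ l)" using e c by (intro mult_left_mono) auto
      then show "exp (- c * real m * y ^ l) \<le> exp (- (c * ((g / \<kappa>) ^ 3 * 5 ^ i)))" by (simp add: mult.assoc)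
    qed (use C in auto)
    also have "\<dots> = C * exp (4 * ln D / \<kappa>\<^sup>2 * 5 ^ i - c * ((g / \<kappa>) ^ 3 * 5 ^ i))"
      by (simp add: exp_diff exp_minus field_simps)
    also have "\<dots> \<le> C * exp (- (L * real (1 + i)))"
    proof (intro mult_left_mono)
      have "(4 * ln D + L) / \<kappa>\<^sup>2 = \<kappa> * (4 * ln D + L) / \<kappa> ^ 3"
        using \<kappa> by (simp add: power2_eq_square power3_eq_cube)
      also have "\<dots> \<le> c * g ^ 3 / \<kappa> ^ 3"
        using \<kappa>'(3) \<kappa> by (intro divide_right_mono) auto
      also have "\<dots> = c * (g / \<kappa>) ^ 3" by (simp add: power_divide)
      finally have "(4 * ln D + L) / \<kappa>\<^sup>2 * 5 ^ i \<le> c * (g / \<kappa>) ^ 3 * 5 ^ i" by (intro mult_right_mono) auto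
      moreover have "L * real (1 + i) \<le> L / \<kappa>\<^sup>2 * 5 ^ i"
      proof (intro mult_mono one_plus_le_five_pow)
        have "\<kappa>\<^sup>2 \<le> 1" using \<kappa>' \<kappa> by (intro power_le_one) auto
        then show "L \<le> L / \<kappa>\<^sup>2" using L \<kappa> mult_left_le[of "\<kappa>\<^sup>2" L] by (simp add: field_simps)
      qed (use L in auto)
      ultimately show "exp (4 * ln D / \<kappa>\<^sup>2 * 5 ^ i - c * ((g / \<kappa>) ^ 3 * 5 ^ i)) \<le> exp (- (L * real (1 + i)))"
        by (simp add: add_divide_distrib algebra_simps)
    qed (use C in auto)
    finally show ?thesis .
  qed
  have "rprob V l m (\<lambda>R. colorable V (H \<union> R)) \<le> rprob V l m (\<lambda>R. \<exists>z\<in>{1..<k} \<times> {..heavy_bound}. ?E (fst z) (snd z) R)"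
    by (rule rprob_mono) (use colorable_imp_many_lists in fastforce)
  also have "\<dots> \<le> (\<Sum>z\<in>{1..<k} \<times> {..heavy_bound}. rprob V l m (?E (fst z) (snd z)))"
    by (rule rprob_Ex_le) simp
  also have "\<dots> \<le> (\<Sum>z\<in>{1..<k} \<times> {..heavy_bound}. C * exp (- (L * real (1 + snd z))))"
    by (intro sum_mono bound) auto
  also have "\<dots> = (\<Sum>a\<in>{1..<k}. \<Sum>i\<le>heavy_bound. C * exp (- (L * real (1 + i))))"
    unfolding sum.cartesian_product by (intro sum.cong) auto
  also have "\<dots> = real (k - 1) * (C * exp (- L) * (\<Sum>i\<le>heavy_bound. exp (- L) ^ i))"
  proof -
    have "exp (- (L * real (1 + i))) = exp (- L) * exp (- L) ^ i" for i
      by (simp add: algebra_simps flip: exp_of_nat_mult exp_add)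
    then show ?thesis by (simp only:) (simp add: sum_distrib_left mult_ac)
  qed
  also have "\<dots> \<le> real k * (C * exp (- L) * 2)"
  proof (intro mult_mono)
    define z where "z = exp (- L)"
    have "z \<le> exp (- 1)" using L by (simp add: z_def)
    also have "\<dots> \<le> 1 / 2" using exp_minus_le_min[of 1] by simp
    finally have z: "0 \<le> z" "z \<le> 1 / 2" by (simp_all add: z_def)
    then have "(\<Sum>i\<le>heavy_bound. z ^ i) \<le> 1 / (1 - z)" by (intro sum_geometric_le) auto
    also have "\<dots> \<le> 2" using z by (simp add: divide_le_eq)
    finally show "(\<Sum>i\<le>heavy_bound. exp (- L) ^ i) \<le> 2" by (simp add: z_def)
  qed (use C in \<open>auto intro!: sum_nonneg mult_nonneg_nonneg\<close>)
  finally show ?thesis by (simp add: mult_ac)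
qed

section \<open>The induction on the uniformity\<close>

text \<open>The inductive statement, with \<open>K\<close> uniform in \<open>V\<close>,
  \<open>H\<close>, \<open>p\<close> and \<open>m\<close>. \<open>sqrt p ^ l\<close> is
  \<open>p^(l/2)\<close> without real exponents, and \<open>p\<close> is only a lower bound for the
  density. The \<open>itself\<close> argument names the vertex type.\<close>

definition forces :: "'a itself \<Rightarrow> nat \<Rightarrow> nat \<Rightarrow> real \<Rightarrow> real \<Rightarrow> bool" where
  "forces _ l k \<delta> K \<longleftrightarrow> (\<forall>(V :: 'a set) H p m. finite V \<longrightarrow> H \<subseteq> ksubs V k \<longrightarrow> 0 < p \<longrightarrow>
     p * real (card V) ^ k \<le> real (card H) \<longrightarrow> K \<le> real m * sqrt p ^ l \<longrightarrow> K \<le> p * real (card V) \<longrightarrow>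
     rprob V l m (\<lambda>R. colorable V (H \<union> R)) \<le> \<delta>)"

lemma forcesD:
  fixes V :: "'a set"
  assumes "forces TYPE('a) l k \<delta> K" "finite V" "H \<subseteq> ksubs V k" "0 < p"
    "p * real (card V) ^ k \<le> real (card H)" "K \<le> real m * sqrt p ^ l" "K \<le> p * real (card V)"
  shows "rprob V l m (\<lambda>R. colorable V (H \<union> R)) \<le> \<delta>"
  using assms unfolding forces_def by blast

text \<open>\<open>K = 1\<close> ensures that \<open>H\<close> has an edge, and a singleton edge is
  always monochromatic.\<close>

lemma forces_1:
  assumes "0 \<le> \<delta>"
  shows "forces TYPE('a) l 1 \<delta> 1"
  unfolding forces_def
proof (intro allI impI)
  fix V :: "'a set" and H p m
  assume *: "finite V" "H \<subseteq> ksubs V 1" "0 < p" "p * real (card V) ^ 1 \<le> real (card H)" "1 \<le> p * real (card V)"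
  then have "H \<noteq> {}" by auto
  then obtain v where "v \<in> V" "{v} \<in> H" using * unfolding ksubs_1 by blast
  then have "\<not> colorable V (H \<union> R)" for R by (auto simp: colorable_def)
  then show "rprob V l m (\<lambda>R. colorable V (H \<union> R)) \<le> \<delta>" using assms by simp
qed

lemma density_le_1:
  assumes "finite V" "H \<subseteq> ksubs V k" "p * real (card V) ^ k \<le> real (card H)" "0 < card V"
  shows "p \<le> 1"
proof -
  have "card H \<le> card V ^ k"
    using card_mono[OF _ assms(2)] card_ksubs_le[OF assms(1), of k] assms(1) by simp
  then have "real (card H) \<le> 1 * real (card V) ^ k" by (simp flip: of_nat_power)
  with assms(3) have "p * real (card V) ^ k \<le> 1 * real (card V) ^ k" by linarith
  then show ?thesis using assms(4) by (simp add: mult_le_cancel_right)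
qed

text \<open>The absolute value makes the threshold nonnegative, so that it can be a summand of a
  constant \<open>K\<close> that must dominate each of its summands.\<close>

lemma exp_neg_le:
  fixes x \<delta> :: real
  assumes "0 < \<delta>" "\<bar>ln (b / \<delta>)\<bar> \<le> x" "0 < b"
  shows "b * exp (- x) \<le> \<delta>"
proof -
  have "exp (ln (b / \<delta>)) \<le> exp x" using assms(2) by (subst exp_le_cancel_iff) linarith
  moreover have "exp (ln (b / \<delta>)) = b / \<delta>" using assms by (intro exp_ln) simp
  ultimately have "b / \<delta> \<le> exp x" by (simp only:)
  then show ?thesis using assms by (simp add: exp_minus field_simps)
qed

lemma forces_2_step:
  assumes k: "2 \<le> k" and IH: "forces TYPE('a) 2 (k - 1) (\<delta> / 2) K1" and K1: "0 < K1" and \<delta>: "0 < \<delta>"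
  shows "\<exists>K>0. forces TYPE('a) 2 k \<delta> K"
proof -
  \<comment> \<open>In order: the hypothesis of \<open>dense_family\<close>; the induction
    hypothesis at density \<open>p / 2\<close> (factor 2) with at least \<open>m / 3\<close> pairs
    (factor 3); failure at most \<open>\<delta> / 2\<close> in a first round of at least
    \<open>m / 2\<close> pairs.\<close>
  define K where "K = 8 * real (k + 1) + 6 * K1 + 32 * real (k + 1) * \<bar>ln (2 / (\<delta> / 2))\<bar>"
  have K: "8 * real (k + 1) \<le> K" "6 * K1 \<le> K" "32 * real (k + 1) * \<bar>ln (2 / (\<delta> / 2))\<bar> \<le> K"
    using K1 by (auto simp: K_def)
  have K0: "8 \<le> K" using K(1) by simp
  have "forces TYPE('a) 2 k \<delta> K"
    unfolding forces_def
  proof (intro allI impI)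
    fix V :: "'a set" and H q m
    assume V: "finite V" and H: "H \<subseteq> ksubs V k" and q: "0 < q"
      and qH: "q * real (card V) ^ k \<le> real (card H)"
      and m: "K \<le> real m * sqrt q ^ 2" and qn: "K \<le> q * real (card V)"
    define n where "n = real (card V)"
    have "0 < q * n" using qn K0 by (simp add: n_def)
    then have n: "0 < n" using q by (simp add: zero_less_mult_iff)
    \<comment> \<open>\<open>dense_family\<close> needs the exact density, which is at least the
      given lower bound \<open>q\<close>.\<close>
    define p where "p = real (card H) / n ^ k"
    have qp: "q \<le> p" using qH n by (simp add: p_def n_def field_simps)
    then have p: "0 < p" using q by simp
    have mp: "K \<le> real m * p" using m q mult_left_mono[OF qp, of "real m"] by simp
    have Kpn: "K \<le> p * n" using qn mult_right_mono[OF qp less_imp_le[OF n]] by (simp only: n_def)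
    interpret dense_family V H k n p "n ^ (k - 1)"
      using V H k n Kpn K by unfold_locales (auto simp: n_def p_def)
    have "1 * p < real m * p" using mp K0 p_le_1 by linarith
    then have "1 < m" using p by (simp add: mult_less_cancel_right)
    then obtain a b where ab: "m = a + b" "real m \<le> 2 * real a" "real m \<le> 3 * real b"
      using halves by blast
    have c2: "2 \<le> card V"
    proof -
      have "8 \<le> p * n" using Kpn K0 by linarith
      also have "\<dots> \<le> 1 * n" using p_le_1 n by (intro mult_right_mono) auto
      finally show ?thesis by (simp add: n_def)
    qed
    have "rprob V 2 (a + b) (\<lambda>R. colorable V (H \<union> R)) \<le>
        rprob V 2 a (\<lambda>R. real (card (covered V (k - 1) H R)) \<le> p * n ^ (k - 1) / 2) + \<delta> / 2"
    proof (rule rprob_add_le)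
      fix R assume R: "R \<in> set_pmf (random_sets V 2 a)"
        and big: "\<not> real (card (covered V (k - 1) H R)) \<le> p * n ^ (k - 1) / 2"
      have "rprob V 2 b (\<lambda>R'. colorable V (H \<union> (R \<union> R'))) \<le> rprob V 2 b (\<lambda>R'. colorable V (covered V (k - 1) H R \<union> R'))"
      proof (rule rprob_mono)
        fix R' assume "colorable V (H \<union> (R \<union> R'))"
        moreover have "r \<noteq> {}" if "r \<in> R" for r
          using set_random_sets[OF V c2 R] that by (auto simp: ksubs_def)
        ultimately show "colorable V (covered V (k - 1) H R \<union> R')"
          using colorable_covered H by blast
      qed
      also have "\<dots> \<le> \<delta> / 2"
      proof (rule forcesD[OF IH V covered_subset, where p = "p / 2"])
        have "real m * p \<le> 3 * real b * p" using ab p by (intro mult_right_mono) auto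
        then have "2 * K1 \<le> real b * p" using mp K by linarith
        then show "K1 \<le> real b * sqrt (p / 2) ^ 2" using p by simp
        show "K1 \<le> p / 2 * real (card V)" using Kpn K K1 unfolding n_def by simp
      qed (use p big in \<open>auto simp: n_def\<close>)
      finally show "rprob V 2 b (\<lambda>R'. colorable V (H \<union> (R \<union> R'))) \<le> \<delta> / 2" .
    qed (use \<delta> in simp)
    also have "rprob V 2 a (\<lambda>R. real (card (covered V (k - 1) H R)) \<le> p * n ^ (k - 1) / 2)
        \<le> 2 * exp (- (p * real a / (16 * real (k + 1))))"
      by (rule rprob_covered)
    also have "\<dots> \<le> \<delta> / 2"
    proof (rule exp_neg_le)
      have "32 * real (k + 1) * \<bar>ln (2 / (\<delta> / 2))\<bar> \<le> real m * p" using K mp by linarith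
      also have "\<dots> \<le> 2 * real a * p" using ab p by (intro mult_right_mono) auto
      finally show "\<bar>ln (2 / (\<delta> / 2))\<bar> \<le> p * real a / (16 * real (k + 1))"
        by (simp add: field_simps)
    qed (use \<delta> in auto)
    finally show "rprob V 2 m (\<lambda>R. colorable V (H \<union> R)) \<le> \<delta>" by (simp add: ab)
  qed
  then show ?thesis using K0 by (intro exI[of _ K]) auto
qed

section \<open>The induction step for \<open>l \<ge> 3\<close>\<close>

lemma rprob_evadable_uniform:
  fixes l :: nat
  assumes l: "0 < l"
  obtains C c where "0 < c" "1 \<le> C"
    "\<And>(V :: 'a set) F y m j. j \<le> k \<Longrightarrow> finite V \<Longrightarrow> F \<subseteq> ksubs V j \<Longrightarrow> 0 < y \<Longrightarrow> y * real (card V) ^ j \<le> real (card F)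
        \<Longrightarrow> 2 ^ (k + 1) * real l \<le> y * real (card V) \<Longrightarrow> rprob V l m (evadable V F) \<le> C * exp (- c * real m * y ^ l)"
proof -
  obtain C c where Cc: "\<And>j. 0 < c j \<and> 1 \<le> C j \<and>
     (\<forall>(V :: 'a set) F y m. finite V \<longrightarrow> F \<subseteq> ksubs V j \<longrightarrow> 0 < y \<longrightarrow> y * real (card V) ^ j \<le> real (card F)
        \<longrightarrow> 2 ^ (j + 1) * real l \<le> y * real (card V) \<longrightarrow> rprob V l m (evadable V F) \<le> C j * exp (- c j * real m * y ^ l))"
    using rprob_evadable[OF l, where 'a = 'a] by metis
  define C' where "C' = Max (C ` {..k})"
  define c' where "c' = Min (c ` {..k})"
  have C': "C j \<le> C'" "c' \<le> c j" if "j \<le> k" for j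
    using that by (auto simp: C'_def c'_def)
  show ?thesis
  proof
    have "c' \<in> c ` {..k}" unfolding c'_def by (intro Min_in) auto
    then show "0 < c'" using Cc by auto
    show "1 \<le> C'" using C'(1)[of 0] Cc[of 0] by simp
    fix V :: "'a set" and F y m j
    assume j: "j \<le> k" and V: "finite V" and F: "F \<subseteq> ksubs V j" "0 < y" "y * real (card V) ^ j \<le> real (card F)"
      and y: "2 ^ (k + 1) * real l \<le> y * real (card V)"
    have "(2 :: real) ^ (j + 1) * real l \<le> 2 ^ (k + 1) * real l"
      using j by (intro mult_right_mono power_increasing) auto
    then have "2 ^ (j + 1) * real l \<le> y * real (card V)" using y by linarith
    then have "rprob V l m (evadable V F) \<le> C j * exp (- c j * real m * y ^ l)"
      using Cc[of j] V F by blast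
    also have "\<dots> \<le> C' * exp (- c' * real m * y ^ l)"
      using C'[of j] Cc[of j] j F by (intro mult_mono) (auto intro!: mult_right_mono)
    finally show "rprob V l m (evadable V F) \<le> C' * exp (- c' * real m * y ^ l)" .
  qed
qed

text \<open>If \<open>T\<close> lies in a class \<open>C\<close>, no member of its link does, so
  \<open>C\<close> evades the link of \<open>T\<close>. Hence a set whose link cannot be evaded by
  \<open>R\<close> is never monochromatic and may serve as an edge.\<close>

lemma colorable_certified:
  assumes "colorable V (H \<union> (R \<union> R'))"
  shows "colorable V ({T \<in> B. \<not> evadable V (nbrs H T) R} \<union> R')"
proof -
  obtain A where A: "A \<subseteq> V" "\<And>e. e \<in> H \<union> (R \<union> R') \<Longrightarrow> \<not> e \<subseteq> A \<and> \<not> e \<subseteq> V - A"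
    using assms by (auto simp: colorable_def)
  have VA: "V - (V - A) = A" using A by auto
  have ev: "evadable V (nbrs H T) R" if "T \<subseteq> C" "C \<in> {A, V - A}" for T C
  proof -
    have "\<not> f \<subseteq> C" if "f \<in> nbrs H T" for f
    proof -
      have "f \<union> T \<in> H" using that by (auto simp: nbrs_def)
      then have "\<not> f \<union> T \<subseteq> C" using A(2)[of "f \<union> T"] \<open>C \<in> {A, V - A}\<close> by auto
      then show ?thesis using \<open>T \<subseteq> C\<close> by blast
    qed
    moreover have "\<not> r \<subseteq> V - C" if "r \<in> R" for r
      using A(2)[of r] that \<open>C \<in> {A, V - A}\<close> VA by auto
    moreover have "C \<subseteq> V" using A \<open>C \<in> {A, V - A}\<close> by auto
    ultimately show ?thesis unfolding evadable_def by (intro exI[of _ C]) auto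
  qed
  have "\<not> e \<subseteq> A \<and> \<not> e \<subseteq> V - A" if "e \<in> {T \<in> B. \<not> evadable V (nbrs H T) R} \<union> R'" for e
    using that A(2)[of e] ev[of e A] ev[of e "V - A"] by auto
  then show ?thesis unfolding colorable_def using A(1) by (intro exI[of _ A]) auto
qed

lemma card_supersets_le:
  assumes "finite V" "H \<subseteq> ksubs V k" "T \<in> ksubs V j"
  shows "card {e \<in> H. T \<subseteq> e} \<le> card V ^ (k - j)"
proof -
  have "card {e \<in> H. T \<subseteq> e} \<le> card (ksubs V (k - j))"
  proof (rule card_inj_on_le[where f = "\<lambda>e. e - T"])
    show "inj_on (\<lambda>e. e - T) {e \<in> H. T \<subseteq> e}" by (auto simp: inj_on_def)
    show "(\<lambda>e. e - T) ` {e \<in> H. T \<subseteq> e} \<subseteq> ksubs V (k - j)"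
      using assms ksubs_finite_elem[OF assms(1,3)] by (auto simp: ksubs_def card_Diff_subset)
  qed (use assms in simp)
  then show ?thesis using card_ksubs_le[OF assms(1), of "k - j"] by linarith
qed

text \<open>For each \<open>T\<close> in \<open>B\<close> the link has density above
  \<open>\<kappa> * sqrt p\<close>, so the first round leaves it evadable only with small constant
  probability. By Markov at least half of \<open>B\<close> gets certified, and the second round
  applies the induction hypothesis to these \<open>j\<close>-sets.\<close>

lemma forces_from_rich_subsets:
  fixes V :: "'a set"
  assumes IH: "forces TYPE('a) l j (\<delta> / 2) K1" and K1: "0 < K1" and \<delta>: "0 < \<delta>" and j: "1 \<le> j" "j < k"
    and C: "1 \<le> C" "0 < c"
    and ev: "\<And>(V :: 'a set) F y m. finite V \<Longrightarrow> F \<subseteq> ksubs V (k - j) \<Longrightarrow> 0 < y \<Longrightarrow> y * real (card V) ^ (k - j) \<le> real (card F)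
        \<Longrightarrow> 2 ^ (k + 1) * real l \<le> y * real (card V) \<Longrightarrow> rprob V l m (evadable V F) \<le> C * exp (- c * real m * y ^ l)"
    and V: "finite V" and H: "H \<subseteq> ksubs V k" and p: "0 < p" "p \<le> 1" and \<kappa>: "0 < \<kappa>"
    and n: "n = real (card V)" "0 < n"
    and B: "B = {T \<in> ksubs V j. \<kappa> * sqrt p * n ^ (k - j) < real (card (nbrs H T))}"
    and rich: "p / (2 * real k) * n ^ j \<le> real (card B)"
    and Km: "2 \<le> real m * sqrt p ^ l" "2 * \<bar>ln (2 * C / (\<delta> / 2))\<bar> \<le> c * \<kappa> ^ l * (real m * sqrt p ^ l)"
      "3 * K1 \<le> real m * sqrt p ^ l * sqrt (1 / (4 * real k)) ^ l"
    and Kn: "2 ^ (k + 1) * real l \<le> \<kappa> * (p * n)" "4 * real k * K1 \<le> p * n"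
  shows "rprob V l m (\<lambda>R. colorable V (H \<union> R)) \<le> \<delta>"
proof -
  have k: "0 < real k" using j by simp
  have sp: "0 < sqrt p" "sqrt p \<le> 1" "p \<le> sqrt p"
  proof -
    have "p * p \<le> p" using p by (simp add: mult_left_le)
    then show "p \<le> sqrt p" using p by (intro real_le_rsqrt) (simp add: power2_eq_square)
  qed (use p in auto)
  have "real m * sqrt p ^ l \<le> real m * 1"
    using sp by (intro mult_left_mono power_le_one) auto
  then have "1 < m" using Km(1) by simp
  then obtain a b where ab: "m = a + b" "real m \<le> 2 * real a" "real m \<le> 3 * real b"
    using halves by blast
  have B0: "0 < real (card B)"
  proof -
    have "0 < p / (2 * real k) * n ^ j" using p n k by simp
    then show ?thesis using rich by linarith
  qed
  have fB: "finite B" using V by (simp add: B)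
  let ?e = "C * exp (- c * real a * (\<kappa> * sqrt p) ^ l)"
  let ?Bad = "\<lambda>R. real (card B) / 2 \<le> real (card {T \<in> B. evadable V (nbrs H T) R})"
  have "rprob V l (a + b) (\<lambda>R. colorable V (H \<union> R)) \<le> rprob V l a ?Bad + \<delta> / 2"
  proof (rule rprob_add_le)
    fix R assume good: "\<not> ?Bad R"
    let ?H = "{T \<in> B. \<not> evadable V (nbrs H T) R}"
    have "rprob V l b (\<lambda>R'. colorable V (H \<union> (R \<union> R'))) \<le> rprob V l b (\<lambda>R'. colorable V (?H \<union> R'))"
      by (rule rprob_mono) (rule colorable_certified)
    also have "\<dots> \<le> \<delta> / 2"
    \<comment> \<open>Half of the density \<open>p / (2 * real k)\<close> of \<open>B\<close>
      remains after certification.\<close>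
    proof (rule forcesD[OF IH V, where p = "p / (4 * real k)"])
      show "?H \<subseteq> ksubs V j" by (auto simp: B)
      show "0 < p / (4 * real k)" using p k by simp
      have "B = ?H \<union> {T \<in> B. evadable V (nbrs H T) R}" by blast
      then have "card B = card ?H + card {T \<in> B. evadable V (nbrs H T) R}"
        using fB by (subst card_Un_disjoint[symmetric]) auto
      then have "real (card B) / 2 \<le> real (card ?H)" using good by simp
      then show "p / (4 * real k) * real (card V) ^ j \<le> real (card ?H)"
        using rich by (simp add: n)
      have "real m * (sqrt p ^ l * sqrt (1 / (4 * real k)) ^ l) \<le> 3 * real b * (sqrt p ^ l * sqrt (1 / (4 * real k)) ^ l)"
        using ab p k by (intro mult_right_mono) auto
      also have "sqrt p ^ l * sqrt (1 / (4 * real k)) ^ l = sqrt (p / (4 * real k)) ^ l"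
        by (simp flip: power_mult_distrib real_sqrt_mult)
      finally show "K1 \<le> real b * sqrt (p / (4 * real k)) ^ l"
        using Km(3) by (simp add: mult.assoc flip: power_mult_distrib real_sqrt_mult)
      show "K1 \<le> p / (4 * real k) * real (card V)"
        using Kn(2) k by (simp add: n field_simps)
    qed
    finally show "rprob V l b (\<lambda>R'. colorable V (H \<union> (R \<union> R'))) \<le> \<delta> / 2" .
  qed (use \<delta> in simp)
  also have "rprob V l a ?Bad \<le> real (card B) * ?e / (real (card B) / 2)"
  proof (rule rprob_card_Markov[OF fB])
    fix T assume T: "T \<in> B"
    show "rprob V l a (evadable V (nbrs H T)) \<le> ?e"
    proof (rule ev[OF V])
      show "nbrs H T \<subseteq> ksubs V (k - j)" using nbrs_subset_ksubs[OF V H] T by (auto simp: B)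
      show "\<kappa> * sqrt p * real (card V) ^ (k - j) \<le> real (card (nbrs H T))" using T by (auto simp: B n)
      have "\<kappa> * (p * n) \<le> \<kappa> * (sqrt p * n)" using sp \<kappa> n by (intro mult_left_mono mult_right_mono) auto
      then show "2 ^ (k + 1) * real l \<le> \<kappa> * sqrt p * real (card V)" using Kn(1) by (simp add: n mult.assoc)
    qed (use \<kappa> sp in simp)
  qed (use B0 in simp)
  also have "\<dots> = 2 * C * exp (- (c * real a * (\<kappa> * sqrt p) ^ l))" using B0 by simp
  also have "\<dots> \<le> \<delta> / 2"
  proof (rule exp_neg_le)
    have "c * \<kappa> ^ l * (real m * sqrt p ^ l) \<le> c * \<kappa> ^ l * (2 * real a * sqrt p ^ l)"
      using ab C \<kappa> sp by (intro mult_left_mono mult_right_mono) auto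
    also have "\<dots> = 2 * (c * real a * (\<kappa> * sqrt p) ^ l)" by (simp add: power_mult_distrib)
    finally show "\<bar>ln (2 * C / (\<delta> / 2))\<bar> \<le> c * real a * (\<kappa> * sqrt p) ^ l" using Km(2) by linarith
  qed (use \<delta> C in auto)
  finally show ?thesis by (simp add: ab)
qed

lemma forces_mono: "forces TYPE('a) l k \<delta> K \<Longrightarrow> K \<le> K' \<Longrightarrow> forces TYPE('a) l k \<delta> K'"
  unfolding forces_def by (meson order_trans)

text \<open>A \<open>j\<close>-set lies in at most \<open>n ^ (k - j)\<close> edges, so each of the
  \<open>k - 1\<close> sizes costs at most \<open>p / (2 * k) * n ^ k\<close> edges. Afterwards no
  edge contains a set with a dense link.\<close>

lemma delete_rich_subsets:
  fixes B :: "nat \<Rightarrow> 'a set set"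
  assumes V: "finite V" and H: "H \<subseteq> ksubs V k" and k: "0 < k" and n: "n = real (card V)" "0 < n" and p: "0 \<le> p"
    and dens: "p * n ^ k \<le> real (card H)"
    and B: "\<And>j. j \<in> {1..<k} \<Longrightarrow> B j \<subseteq> ksubs V j" "\<And>j. j \<in> {1..<k} \<Longrightarrow> real (card (B j)) \<le> p / (2 * real k) * n ^ j"
  shows "p / 2 * n ^ k \<le> real (card {e \<in> H. \<forall>j\<in>{1..<k}. \<forall>T\<in>B j. \<not> T \<subseteq> e})"
proof -
  let ?H = "{e \<in> H. \<forall>j\<in>{1..<k}. \<forall>T\<in>B j. \<not> T \<subseteq> e}"
  let ?D = "\<Union>j\<in>{1..<k}. \<Union>T\<in>B j. {e \<in> H. T \<subseteq> e}"
  have fH: "finite H" using H V finite_subset by fastforce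
  have fB: "finite (B j)" if "j \<in> {1..<k}" for j using B(1)[OF that] V finite_subset by fastforce
  have "H \<subseteq> ?H \<union> ?D" by blast
  moreover have "finite (?H \<union> ?D)" by (rule finite_subset[OF _ fH]) auto
  ultimately have "card H \<le> card (?H \<union> ?D)" by (rule card_mono[rotated])
  also have "\<dots> \<le> card ?H + card ?D" by (rule card_Un_le)
  finally have "real (card H) \<le> real (card ?H) + real (card ?D)" by simp
  also have "card ?D \<le> (\<Sum>j\<in>{1..<k}. card (\<Union>T\<in>B j. {e \<in> H. T \<subseteq> e}))"
    by (rule card_UN_le) simp
  also have "\<dots> \<le> (\<Sum>j\<in>{1..<k}. \<Sum>T\<in>B j. card {e \<in> H. T \<subseteq> e})"
    by (intro sum_mono card_UN_le fB)
  also have "\<dots> \<le> (\<Sum>j\<in>{1..<k}. \<Sum>T\<in>B j. card V ^ (k - j))"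
    using B(1) by (intro sum_mono card_supersets_le[OF V H]) blast
  also have "real (\<Sum>j\<in>{1..<k}. \<Sum>T\<in>B j. card V ^ (k - j)) = (\<Sum>j\<in>{1..<k}. real (card (B j)) * n ^ (k - j))"
    by (simp add: n)
  also have "\<dots> \<le> (\<Sum>j\<in>{1..<k}. p / (2 * real k) * n ^ k)"
  proof (rule sum_mono)
    fix j assume j: "j \<in> {1..<k}"
    have "real (card (B j)) * n ^ (k - j) \<le> p / (2 * real k) * n ^ j * n ^ (k - j)"
      using B(2)[OF j] n by (intro mult_right_mono) auto
    also have "\<dots> = p / (2 * real k) * n ^ k"
      using j by (simp flip: power_add)
    finally show "real (card (B j)) * n ^ (k - j) \<le> p / (2 * real k) * n ^ k" .
  qed
  also have "\<dots> = real (k - 1) / real k * (p / 2 * n ^ k)" by simp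
  also have "\<dots> \<le> 1 * (p / 2 * n ^ k)"
    using p n k by (intro mult_right_mono) auto
  finally show ?thesis using dens by simp
qed

text \<open>Either for some \<open>j\<close> the \<open>j\<close>-sets with dense links are numerous
  and the induction hypothesis for \<open>j\<close> applies, or they can be deleted and the rest is
  a \<open>spread_family\<close>.\<close>

lemma forces_3_step:
  assumes l: "3 \<le> l" and k: "2 \<le> k" and \<delta>: "0 < \<delta>"
    and IH: "\<And>j. 1 \<le> j \<Longrightarrow> j < k \<Longrightarrow> \<exists>K>0. forces TYPE('a) l j (\<delta> / 2) K"
  shows "\<exists>K>0. forces TYPE('a) l k \<delta> K"
proof -
  obtain Kf where Kf: "\<And>j. 1 \<le> j \<Longrightarrow> j < k \<Longrightarrow> 0 < Kf j \<and> forces TYPE('a) l j (\<delta> / 2) (Kf j)"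
    using IH by metis
  define K1 where "K1 = (\<Sum>j\<in>{1..<k}. Kf j)"
  have K1: "0 < K1" unfolding K1_def using Kf k by (intro sum_pos) auto
  have K1f: "forces TYPE('a) l j (\<delta> / 2) K1" if "1 \<le> j" "j < k" for j
  proof (rule forces_mono)
    show "Kf j \<le> K1" unfolding K1_def
      using that Kf by (intro member_le_sum) (auto intro: less_imp_le)
  qed (use Kf that in auto)
  have l0: "0 < l" using l by simp
  obtain C c where c: "0 < c" and C: "1 \<le> C" and
    ev: "\<And>(V :: 'a set) F y m j. j \<le> k \<Longrightarrow> finite V \<Longrightarrow> F \<subseteq> ksubs V j \<Longrightarrow> 0 < y \<Longrightarrow> y * real (card V) ^ j \<le> real (card F)
        \<Longrightarrow> 2 ^ (k + 1) * real l \<le> y * real (card V) \<Longrightarrow> rprob V l m (evadable V F) \<le> C * exp (- c * real m * y ^ l)"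
    by (rule rprob_evadable_uniform[OF l0, where k = k and 'a = 'a]) (rule that)
  define g where "g = 1 / ((32 * real k)\<^sup>2 * 2 ^ (k + 5))"
  define D where "D = 2 ^ (k + 3) * (32 * real k)"
  define L where "L = 1 + \<bar>ln (real k * 2 * C / \<delta>)\<bar>"
  \<comment> \<open>The last term lets the one-sided gain cover the list cost plus \<open>L\<close>;
    \<open>L\<close> is chosen so that
    \<open>real k * 2 * C * exp (- L) \<le> \<delta>\<close>.\<close>
  define \<kappa> where "\<kappa> = min (1 / 2) (min g (c * g ^ 3 / (4 * ln D + L)))"
  have g: "0 < g" using k by (simp add: g_def)
  have "1 * 32 \<le> D" unfolding D_def using k by (intro mult_mono) auto
  then have lnD: "0 \<le> ln D" by simp
  have L: "1 \<le> L" by (simp add: L_def)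
  have DL: "0 < 4 * ln D + L" using lnD L by linarith
  have \<kappa>: "0 < \<kappa>" "\<kappa> \<le> 1 / 2" "\<kappa> \<le> g" "\<kappa> * (4 * ln D + L) \<le> c * g ^ 3"
  proof -
    have "\<kappa> \<le> c * g ^ 3 / (4 * ln D + L)" by (simp add: \<kappa>_def)
    then show "\<kappa> * (4 * ln D + L) \<le> c * g ^ 3" using DL by (simp add: pos_le_divide_eq)
    show "\<kappa> \<le> 1 / 2" unfolding \<kappa>_def by (rule min.cobounded1)
  qed (use g c DL in \<open>auto simp: \<kappa>_def\<close>)
  \<comment> \<open>Deletion may halve the density, so \<open>sqrt p2\<close> is only known to be at
    least \<open>sqrt p / 2\<close>; testing links against \<open>\<kappa> / 2\<close>
    compensates.\<close>
  define \<kappa>1 where "\<kappa>1 = \<kappa> / 2"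
  have \<kappa>1: "0 < \<kappa>1" using \<kappa> by (simp add: \<kappa>1_def)
  define s where "s = sqrt (1 / (4 * real k)) ^ l"
  have s: "0 < s" using k by (simp add: s_def)
  \<comment> \<open>The first five summands serve the case of many dense links. The last two serve
    the deleted family, where \<open>sqrt p\<close> drops by at most a factor 2 (hence
    \<open>2 ^ l\<close>) and \<open>p\<close> by at most a factor 2.\<close>
  define K where "K = 2 + 2 * \<bar>ln (2 * C / (\<delta> / 2))\<bar> / (c * \<kappa>1 ^ l) + 3 * K1 / s + 2 ^ (k + 1) * real l / \<kappa>1
      + 4 * real k * K1 + 2 ^ l + 2 * (2 ^ (k + 1) * real l)"
  have nn: "0 \<le> 2 * \<bar>ln (2 * C / (\<delta> / 2))\<bar> / (c * \<kappa>1 ^ l)" "0 \<le> 3 * K1 / s" "0 \<le> 2 ^ (k + 1) * real l / \<kappa>1"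
     "0 \<le> 4 * real k * K1" "0 \<le> (2 :: real) ^ l" "0 \<le> 2 * (2 ^ (k + 1) * real l)"
    using c \<kappa>1 K1 s by auto
  have K: "2 \<le> K" "2 * \<bar>ln (2 * C / (\<delta> / 2))\<bar> / (c * \<kappa>1 ^ l) \<le> K" "3 * K1 / s \<le> K" "2 ^ (k + 1) * real l / \<kappa>1 \<le> K"
     "4 * real k * K1 \<le> K" "2 ^ l \<le> K" "2 * (2 ^ (k + 1) * real l) \<le> K"
    unfolding K_def using nn by linarith+
  have "forces TYPE('a) l k \<delta> K"
    unfolding forces_def
  proof (intro allI impI)
    fix V :: "'a set" and H p m
    assume V: "finite V" and H: "H \<subseteq> ksubs V k" and p: "0 < p"
      and pH: "p * real (card V) ^ k \<le> real (card H)"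
      and m: "K \<le> real m * sqrt p ^ l" and pn: "K \<le> p * real (card V)"
    define n where "n = real (card V)"
    have "0 < p * n" using pn K by (simp add: n_def)
    then have n: "0 < n" using p by (simp add: zero_less_mult_iff)
    have p1: "p \<le> 1" using density_le_1[OF V H pH] n by (simp add: n_def)
    define B where "B j = {T \<in> ksubs V j. \<kappa>1 * sqrt p * n ^ (k - j) < real (card (nbrs H T))}" for j
    show "rprob V l m (\<lambda>R. colorable V (H \<union> R)) \<le> \<delta>"
    proof (cases "\<exists>j\<in>{1..<k}. p / (2 * real k) * n ^ j \<le> real (card (B j))")
      case True
      then obtain j where j: "1 \<le> j" "j < k" and rich: "p / (2 * real k) * n ^ j \<le> real (card (B j))" by auto
      show ?thesis
      proof (rule forces_from_rich_subsets[OF K1f[OF j] K1 \<delta> j C c _ V H p p1 \<kappa>1 n_def n B_def rich])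
        have "2 * \<bar>ln (2 * C / (\<delta> / 2))\<bar> / (c * \<kappa>1 ^ l) \<le> real m * sqrt p ^ l" using K m by linarith
        then show "2 * \<bar>ln (2 * C / (\<delta> / 2))\<bar> \<le> c * \<kappa>1 ^ l * (real m * sqrt p ^ l)"
          using c \<kappa>1 by (subst (asm) pos_divide_le_eq) (simp_all add: mult_ac)
        have "3 * K1 / s \<le> real m * sqrt p ^ l" using K m by linarith
        then show "3 * K1 \<le> real m * sqrt p ^ l * sqrt (1 / (4 * real k)) ^ l"
          using s unfolding s_def[symmetric] by (simp add: pos_divide_le_eq)
        have "2 ^ (k + 1) * real l / \<kappa>1 \<le> p * n" using K pn by (simp add: n_def)
        then show "2 ^ (k + 1) * real l \<le> \<kappa>1 * (p * n)" using \<kappa>1 by (simp add: pos_divide_le_eq mult_ac)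
        show "4 * real k * K1 \<le> p * n" using K pn by (simp add: n_def)
        show "2 \<le> real m * sqrt p ^ l" using K m by linarith
      qed (rule ev, simp_all)
    next
      case False
      define H2 where "H2 = {e \<in> H. \<forall>j\<in>{1..<k}. \<forall>T\<in>B j. \<not> T \<subseteq> e}"
      define p2 where "p2 = real (card H2) / n ^ k"
      have "p / 2 * n ^ k \<le> real (card H2)"
        unfolding H2_def
        using False pH p k by (intro delete_rich_subsets[OF V H _ n_def n]) (auto simp: n_def B_def not_le intro: less_imp_le)
      then have p2: "p / 2 \<le> p2" using n by (simp add: p2_def pos_le_divide_eq)
      have p20: "0 < p2" using p2 p by simp
      have H2: "H2 \<subseteq> H" "H2 \<subseteq> ksubs V k" using H by (auto simp: H2_def)
      have p21: "p2 \<le> 1"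
        using density_le_1[OF V H2(2), of p2] n by (simp add: p2_def n_def)
      have sq: "sqrt p / 2 \<le> sqrt p2"
      proof -
        have "sqrt p / 2 = sqrt (p / 4)" by (simp add: real_sqrt_divide)
        also have "\<dots> \<le> sqrt p2" using p2 p by simp
        finally show ?thesis .
      qed
      have sf: "spread_family V H2 k n p2 \<kappa>"
      proof
        fix a S assume a: "1 \<le> a" "a < k" and S: "S \<in> ksubs V a"
        have "\<kappa>1 * sqrt p * n ^ (k - a) \<le> \<kappa> * sqrt p2 * n ^ (k - a)"
          using mult_left_mono[OF sq, of \<kappa>] \<kappa> n by (intro mult_right_mono) (auto simp: \<kappa>1_def)
        moreover have "real (card (nbrs H2 S)) \<le> \<kappa>1 * sqrt p * n ^ (k - a)"
        proof (cases "S \<in> B a")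
          \<comment> \<open>Every edge of \<open>H\<close> containing \<open>S\<close> was
            deleted.\<close>
          case True
          then have "nbrs H2 S = {}" using a by (auto simp: nbrs_def H2_def)
          then show ?thesis using \<kappa>1 p n by simp
        next
          case False
          have "card (nbrs H2 S) \<le> card (nbrs H S)"
            by (rule card_mono[OF finite_nbrs[OF V H] nbrs_mono[OF H2(1)]])
          then show ?thesis using False S by (simp add: B_def)
        qed
        ultimately show "real (card (nbrs H2 S)) \<le> \<kappa> * sqrt p2 * n ^ (k - a)" by linarith
      qed (use V H2 k n p20 \<kappa> in \<open>auto simp: n_def p2_def\<close>)
      have "rprob V l m (\<lambda>R. colorable V (H \<union> R)) \<le> rprob V l m (\<lambda>R. colorable V (H2 \<union> R))"
        using H2 by (intro rprob_mono) (auto intro: colorable_antimono[rotated])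
      also have "\<dots> \<le> real k * (2 * C * exp (- L))"
      proof (rule spread_family.rprob_colorable_le[OF sf _ c L _ p21 _ l _ \<kappa>(2) \<kappa>(3)[unfolded g_def] \<kappa>(4)[unfolded g_def D_def]])
        fix a F y
        assume "a < k" "F \<subseteq> ksubs V (k - a)" "0 < y" "y * n ^ (k - a) \<le> real (card F)" "2 ^ (k + 1) * real l \<le> y * n"
        then show "rprob V l m (evadable V F) \<le> C * exp (- c * real m * y ^ l)"
          using ev[of "k - a" V F y m] V by (simp add: n_def)
      next
        have "p / 2 * n \<le> p2 * n" using p2 n by (intro mult_right_mono) auto
        then show "2 ^ (k + 1) * real l \<le> p2 * n" using K(7) pn by (simp add: n_def)
        have "real m * (sqrt p / 2) ^ l \<le> real m * sqrt p2 ^ l"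
          using sq p by (intro mult_left_mono power_mono) auto
        moreover have "1 \<le> real m * (sqrt p / 2) ^ l"
          using K(6) m by (simp add: power_divide)
        ultimately show "1 \<le> real m * sqrt p2 ^ l" by linarith
      qed (use C in simp)
      also have "real k * (2 * C * exp (- L)) = real k * 2 * C * exp (- L)" by simp
      also have "\<dots> \<le> \<delta>"
        using \<delta> C k by (intro exp_neg_le) (auto simp: L_def)
      finally show ?thesis .
    qed
  qed
  then show ?thesis using K(1) by (intro exI[of _ K]) auto
qed

lemma ex_forces:
  assumes "2 \<le> l" "1 \<le> k" "0 < \<delta>"
  shows "\<exists>K>0. forces TYPE('a) l k \<delta> K"
  using assms(2,3)
proof (induction k arbitrary: \<delta> rule: less_induct)
  case (less k)
  consider "k = 1" | "2 \<le> k" "l = 2" | "2 \<le> k" "3 \<le> l" using less.prems assms(1) by linarith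
  then show ?case
  proof cases
    case 1
    then show ?thesis using forces_1[of \<delta> l, where 'a = 'a] less.prems by (intro exI[of _ 1]) auto
  next
    case 2
    have "1 \<le> k - 1" "k - 1 < k" using 2 by linarith+
    then obtain K where "0 < K" "forces TYPE('a) l (k - 1) (\<delta> / 2) K"
      using less.IH[of "k - 1" "\<delta> / 2"] less.prems(2) by (meson half_gt_zero)
    then show ?thesis
      using forces_2_step[OF 2(1) _ _ less.prems(2), where 'a = 'a] unfolding 2(2) by blast
  next
    case 3
    show ?thesis
    proof (rule forces_3_step[OF 3(2,1) less.prems(2)])
      fix j assume "1 \<le> j" "j < k"
      then show "\<exists>K>0. forces TYPE('a) l j (\<delta> / 2) K"
        using less.prems(2) by (intro less.IH) simp_all
    qed
  qed
qed

text \<open>Union bound over colourings that ignores \<open>H\<close>: some class has at least half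
  of the vertices and must contain no random set.\<close>

lemma rprob_colorable_trivial:
  fixes V :: "'a set"
  assumes V: "finite V" and l: "0 < l" "4 * l \<le> card V"
  shows "rprob V l m (\<lambda>R. colorable V (H \<union> R)) \<le> 2 ^ card V * exp (- (real m * (1 / 4) ^ l))"
proof -
  let ?I = "{X \<in> Pow V. card V \<le> 2 * card X}"
  have V0: "0 < card V" using l by linarith
  have lV: "l \<le> card V" using l by linarith
  have "rprob V l m (\<lambda>R. colorable V (H \<union> R)) \<le> rprob V l m (\<lambda>R. \<exists>X\<in>?I. \<forall>r\<in>R. \<not> r \<subseteq> X)"
  proof (rule rprob_mono)
    fix R assume "colorable V (H \<union> R)"
    then obtain A where A: "A \<subseteq> V" "\<And>e. e \<in> R \<Longrightarrow> \<not> e \<subseteq> A \<and> \<not> e \<subseteq> V - A"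
      by (auto simp: colorable_def)
    have "card V = card A + card (V - A)"
      using V A by (metis card_Diff_subset card_mono finite_subset le_add_diff_inverse)
    then consider "card V \<le> 2 * card A" | "card V \<le> 2 * card (V - A)" by linarith
    then show "\<exists>X\<in>?I. \<forall>r\<in>R. \<not> r \<subseteq> X"
    proof cases
      case 1
      then show ?thesis using A by (intro bexI[of _ A]) auto
    next
      case 2
      then show ?thesis using A by (intro bexI[of _ "V - A"]) auto
    qed
  qed
  also have "\<dots> \<le> (\<Sum>X\<in>?I. rprob V l m (\<lambda>R. \<forall>r\<in>R. \<not> r \<subseteq> X))"
    using V by (intro rprob_Ex_le) auto
  also have "\<dots> \<le> (\<Sum>X\<in>?I. exp (- (real m * (1 / 4) ^ l)))"
  proof (rule sum_mono)
    fix X assume X: "X \<in> ?I"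
    have "rprob V l m (\<lambda>R. \<forall>r\<in>R. \<not> r \<subseteq> X) \<le> exp (- real m * (real (card X) / (2 * real (card V))) ^ l)"
      using X l lV by (intro rprob_none_contained V) auto
    also have "\<dots> \<le> exp (- (real m * (1 / 4) ^ l))"
    proof -
      have "real (card V) \<le> real (2 * card X)" using X by (simp only: of_nat_le_iff mem_Collect_eq)
      then have "1 / 4 \<le> real (card X) / (2 * real (card V))" using V0 by (simp add: field_simps)
      then have "real m * (1 / 4) ^ l \<le> real m * (real (card X) / (2 * real (card V))) ^ l"
        by (intro mult_left_mono power_mono) auto
      then show ?thesis by simp
    qed
    finally show "rprob V l m (\<lambda>R. \<forall>r\<in>R. \<not> r \<subseteq> X) \<le> exp (- (real m * (1 / 4) ^ l))" .
  qed
  also have "\<dots> = real (card ?I) * exp (- (real m * (1 / 4) ^ l))" by simp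
  also have "card ?I \<le> card (Pow V)" using V by (intro card_mono) auto
  also have "card (Pow V) = 2 ^ card V" by (rule card_Pow[OF V])
  finally show ?thesis by simp
qed

section \<open>Back to hypergraphs and random tuples\<close>

lemma two_colorable_add_edges:
  "two_colorable (add_edges H F) \<longleftrightarrow> colorable (verts H) (edges H \<union> F)"
proof -
  let ?P = "\<lambda>A B. \<forall>e\<in>edges H \<union> F. \<not> e \<subseteq> A \<and> \<not> e \<subseteq> B"
  have "two_colorable (add_edges H F) \<longleftrightarrow> (\<exists>A B. A \<union> B = verts H \<and> A \<inter> B = {} \<and> ?P A B)"
    by (simp add: two_colorable_def add_edges_def)
  also have "\<dots> \<longleftrightarrow> (\<exists>A\<subseteq>verts H. ?P A (verts H - A))"
  proof
    assume "\<exists>A B. A \<union> B = verts H \<and> A \<inter> B = {} \<and> ?P A B"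
    then obtain A B where AB: "A \<union> B = verts H" "A \<inter> B = {}" "?P A B" by blast
    then have "B = verts H - A" "A \<subseteq> verts H" by auto
    with AB(3) show "\<exists>A\<subseteq>verts H. ?P A (verts H - A)" by (intro exI[of _ A]) simp
  next
    assume "\<exists>A\<subseteq>verts H. ?P A (verts H - A)"
    then obtain A where "A \<subseteq> verts H" "?P A (verts H - A)" by blast
    then show "\<exists>A B. A \<union> B = verts H \<and> A \<inter> B = {} \<and> ?P A B"
      by (intro exI[of _ A] exI[of _ "verts H - A"]) (simp add: Un_absorb1)
  qed
  finally show ?thesis by (simp add: colorable_def)
qed

lemma prob_not_two_colorable:
  "measure_pmf.prob (random_tuples (verts H) l m) {R. \<not> two_colorable (add_edges H (R ` {..<m}))}
     = 1 - rprob (verts H) l m (\<lambda>R. colorable (verts H) (edges H \<union> R))"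
proof -
  have "rprob (verts H) l m (\<lambda>R. colorable (verts H) (edges H \<union> R)) =
     measure_pmf.prob (random_tuples (verts H) l m) {R. two_colorable (add_edges H (R ` {..<m}))}"
    by (simp add: two_colorable_add_edges vimage_def flip: map_random_tuples)
  then show ?thesis
    using measure_pmf.prob_compl[of "{R. two_colorable (add_edges H (R ` {..<m}))}" "random_tuples (verts H) l m"]
    by (simp add: Compl_eq_Diff_UNIV[symmetric] Collect_neg_eq)
qed

theorem theorem1p1:
  fixes k l :: nat and \<epsilon> :: real
    and H :: "nat \<Rightarrow> 'a hypergraph" and m :: "nat \<Rightarrow> nat"
  assumes "k \<ge> 2" and "l \<ge> 2" and "\<epsilon> \<ge> 0"
    and "\<And>n. uniform_hypergraph k (H n)"
    and "\<And>n. card (verts (H n)) = n"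
    and "\<And>n. two_colorable (H n)"
    and "(\<lambda>n. real (card (edges (H n)))) \<in> \<Omega>(\<lambda>n. real n powr (real k - \<epsilon>))"
    and "(\<lambda>n. real (m n)) \<in> \<omega>(\<lambda>n. real n powr (real l * \<epsilon> / 2))"
  shows "(\<lambda>n. measure_pmf.prob (random_tuples (verts (H n)) l (m n))
            {R. \<not> two_colorable (add_edges (H n) (R ` {..<m n}))}) \<longlonglongrightarrow> 1"
proof -
  let ?q = "\<lambda>n. rprob (verts (H n)) l (m n) (\<lambda>R. colorable (verts (H n)) (edges (H n) \<union> R))"
  have V: "finite (verts (H n))" "edges (H n) \<subseteq> ksubs (verts (H n)) k" for n
    using assms(4)[of n] by (auto simp: uniform_hypergraph_def ksubs_def)
  have m: "eventually (\<lambda>n. M * real n powr (real l * \<epsilon> / 2) \<le> real (m n)) sequentially" if "0 < M" for M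
    using landau_omega.smallD[OF assms(8) that] by (simp add: norm_powr_real)
  have small: "eventually (\<lambda>n. ?q n \<le> \<delta>) sequentially" if \<delta>: "0 < \<delta>" for \<delta>
  \<comment> \<open>In the first case \<open>m\<close> outgrows \<open>n\<close> and the union bound
    suffices. In the second, \<open>2 \<le> l\<close> gives \<open>\<epsilon> < 1\<close>, so that
    \<open>p * n\<close> is unbounded as \<open>forces\<close> requires.\<close>
  proof (cases "1 \<le> real l * \<epsilon> / 2")
    case True
    have "eventually (\<lambda>n. \<bar>ln (1 / \<delta>)\<bar> \<le> real n) sequentially"
      by real_asymp
    moreover have "eventually (\<lambda>n. 4 * l + 1 \<le> n) sequentially" by (rule eventually_ge_at_top)
    \<comment> \<open>\<open>4 ^ l\<close> cancels \<open>(1 / 4) ^ l\<close> in the exponent, and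
      the factor 2 beats \<open>2 ^ n \<le> exp n\<close>.\<close>
    moreover have "eventually (\<lambda>n. (2 * 4 ^ l) * real n powr (real l * \<epsilon> / 2) \<le> real (m n)) sequentially"
      by (rule m) simp
    ultimately show ?thesis
    proof eventually_elim
      case (elim n)
      have "real n = real n powr 1" using elim(2) by simp
      also have "\<dots> \<le> real n powr (real l * \<epsilon> / 2)" using True elim(2) by (intro powr_mono) auto
      finally have "2 * 4 ^ l * real n \<le> 2 * 4 ^ l * real n powr (real l * \<epsilon> / 2)" by simp
      also have "\<dots> \<le> real (m n)" by (rule elim(3))
      finally have mn: "2 * real n \<le> real (m n) * (1 / 4) ^ l"
        by (simp add: power_one_over field_simps)
      have "?q n \<le> 2 ^ card (verts (H n)) * exp (- (real (m n) * (1 / 4) ^ l))"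
        using assms(2,5) elim(2) by (intro rprob_colorable_trivial V) auto
      also have "\<dots> \<le> exp (real n) * exp (- (2 * real n))"
      proof (intro mult_mono)
        have "2 ^ n \<le> exp (1 :: real) ^ n"
          using exp_ge_add_one_self[of 1] by (intro power_mono) auto
        then show "2 ^ card (verts (H n)) \<le> exp (real n)" using assms(5) by (simp flip: exp_of_nat_mult)
      qed (use mn in auto)
      also have "\<dots> = 1 * exp (- real n)" by (simp flip: exp_add)
      also have "\<dots> \<le> \<delta>" using \<delta> elim(1) by (intro exp_neg_le) auto
      finally show ?case .
    qed
  next
    case False
    have "2 * \<epsilon> \<le> real l * \<epsilon>" using assms(2,3) by (intro mult_right_mono) auto
    then have \<epsilon>: "\<epsilon> < 1" using False by linarith
    obtain K where K: "0 < K" "forces TYPE('a) l k \<delta> K"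
      using ex_forces[of l k \<delta>, where 'a = 'a] assms(1,2) \<delta> by auto
    obtain c where c: "0 < c" "eventually (\<lambda>n. c * real n powr (real k - \<epsilon>) \<le> real (card (edges (H n)))) sequentially"
      using landau_omega.bigE[OF assms(7)] by (auto simp: norm_powr_real)
    have "eventually (\<lambda>n. K \<le> c * real n powr (1 - \<epsilon>)) sequentially"
      using c(1) \<epsilon> by real_asymp
    moreover have "eventually (\<lambda>n. 1 \<le> n) sequentially" by (rule eventually_ge_at_top)
    moreover have "eventually (\<lambda>n. (K / sqrt c ^ l) * real n powr (real l * \<epsilon> / 2) \<le> real (m n)) sequentially"
      using K(1) c(1) by (intro m) simp
    ultimately show ?thesis using c(2)
    proof eventually_elim
      case (elim n)
      \<comment> \<open>With this density, \<open>p * n ^ k\<close> is the assumed number of edges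
        and \<open>sqrt p ^ l\<close> is a constant times
        \<open>n powr (- (l * \<epsilon> / 2))\<close>, matching the growth assumed for
        \<open>m\<close>.\<close>
      define p where "p = c * real n powr (- \<epsilon>)"
      have n: "0 < real n" using elim by simp
      have sp: "sqrt p ^ l = sqrt c ^ l * real n powr (- (real l * \<epsilon> / 2))"
      proof -
        have "sqrt (real n powr (- \<epsilon>)) = real n powr (- \<epsilon> / 2)"
          by (rule real_sqrt_unique) (simp_all add: power2_eq_square flip: powr_add)
        then have "sqrt p ^ l = sqrt c ^ l * (real n powr (- \<epsilon> / 2)) ^ l"
          by (simp add: p_def real_sqrt_mult power_mult_distrib)
        also have "(real n powr (- \<epsilon> / 2)) ^ l = real n powr (- (real l * \<epsilon> / 2))"
          using n by (simp add: powr_power mult.commute)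
        finally show ?thesis .
      qed
      show ?case
      proof (rule forcesD[OF K(2) V, where p = p])
        show "0 < p" using c n by (simp add: p_def)
        have "p * real n ^ k = c * real n powr (real k - \<epsilon>)"
          using n by (simp add: p_def powr_realpow[symmetric] flip: powr_add)
        then show "p * real (card (verts (H n))) ^ k \<le> real (card (edges (H n)))"
          using elim(4) assms(5) by simp
        have "K = K / sqrt c ^ l * real n powr (real l * \<epsilon> / 2) * (sqrt c ^ l * real n powr (- (real l * \<epsilon> / 2)))"
          using c n by (simp flip: powr_add)
        also have "\<dots> \<le> real (m n) * (sqrt c ^ l * real n powr (- (real l * \<epsilon> / 2)))"
          using elim(3) c by (intro mult_right_mono) auto
        finally show "K \<le> real (m n) * sqrt p ^ l" by (simp only: sp)
        have "p * real n = c * real n powr (1 - \<epsilon>)"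
          using n powr_add[of "real n" "- \<epsilon>" 1] by (simp add: p_def)
        then show "K \<le> p * real (card (verts (H n)))" using elim(1) assms(5) by simp
      qed
    qed
  qed
  have "?q \<longlonglongrightarrow> 0"
  proof (rule order_tendstoI)
    fix a :: real assume "a < 0"
    then show "eventually (\<lambda>n. a < ?q n) sequentially"
      by (intro always_eventually allI less_le_trans[OF _ measure_nonneg])
  next
    fix a :: real assume "0 < a"
    then have "eventually (\<lambda>n. ?q n \<le> a / 2) sequentially" by (intro small) simp
    then show "eventually (\<lambda>n. ?q n < a) sequentially"
      by eventually_elim (use \<open>0 < a\<close> in simp)
  qed
  then have "(\<lambda>n. 1 - ?q n) \<longlonglongrightarrow> 1 - 0" by (intro tendsto_intros)
  then show ?thesis by (simp add: prob_not_two_colorable)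
qed

end
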